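(* Let $F$ be a differential field of characteristic zero, let $E=F(\theta_1,\dots,\theta_n)$ be a transcendental dilogarithmic-elementary extension of $F$ with $C_E=C_F$, and let $u\in E$. Then $u'\in F$ if and only if there are a finite indexing set $I$, elements $r_i\in F$ and $g_i\in F\setminus\{0,1\}$ for $i\in I$, an element $w\in F$, and constants $c_i, c_{ij}\in C_F$ ($i,j\in I$) with $c_{ij}=c_{ji}$ such that $$u'=\sum_{i\in I}r_i\frac{g_i'}{g_i}+w'$$ and, for every $i\in I$, $$r_i'=c_i\frac{(1-g_i)'}{1-g_i}+\sum_{j\in I}c_{ij}\frac{g_j'}{g_j}.$$
   Context: All fields have characteristic zero. A differential field is a field with a single derivation $'$; $C_F$ denotes the field of constants (kernel of the derivation) of $F$. If $\theta,\eta$ lie in a differential field, $\eta\neq 0$ and $\theta'=\eta'/\eta$, then $\theta$ is called a logarithm of $\eta$ and $\eta$ is called an exponential of $\theta$. For a differential field $K$ and $g\in K\setminus\{0,1\}$, an element $\ell_2(g)\in K$ is a dilogarithm (dilogarithmic integral) of $g$ if there is $\vartheta\in K$ with $\vartheta'=-(1-g)'/(1-g)$ and $\ell_2(g)'=(g'/g)\,\vartheta$. A differential field extension $E=F(\theta_1,\dots,\theta_n)$ of $F$, with $F_0:=F$ and $F_i:=F_{i-1}(\theta_i)$ (each a differential field), is a dilogarithmic-elementary extension of $F$ if for each $i$ one of the following holds: $\theta_i$ is algebraic over $F_{i-1}$; $\theta_i$ is an exponential of an element of $F_{i-1}$; $\theta_i$ is a logarithm of an element of $F_{i-1}$; or there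 is $g\in F_{i-1}\setminus\{0,1\}$ such that $\theta_i$ is a dilogarithm of $g$. It is a transcendental dilogarithmic-elementary extension if, moreover, no $\theta_i$ is algebraic over $F_{i-1}$. *)

theory Defs
  imports "HOL-Computational_Algebra.Polynomial"
begin

text \<open>
  Fields are carried by subsets of a type of class field_char_0, so that a whole tower of fields
  lives in one type. The derivation is a function on the type of which nothing is assumed
  outside the fields under consideration; an abstract differential field is the case where the
  carrier is UNIV.
\<close>

definition is_subfield :: "'a::field_char_0 set \<Rightarrow> bool" where
  "is_subfield K \<longleftrightarrow> 1 \<in> K \<and> (\<forall>x\<in>K. \<forall>y\<in>K. x - y \<in> K \<and> x * y \<in> K) \<and> (\<forall>x\<in>K. inverse x \<in> K)"

definition differential_field :: "('a::field_char_0 \<Rightarrow> 'a) \<Rightarrow> 'a set \<Rightarrow> bool" where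
  "differential_field D K \<longleftrightarrow> is_subfield K \<and>
     (\<forall>x\<in>K. D x \<in> K) \<and>
     (\<forall>x\<in>K. \<forall>y\<in>K. D (x + y) = D x + D y \<and> D (x * y) = D x * y + x * D y)"

definition constants :: "('a::field_char_0 \<Rightarrow> 'a) \<Rightarrow> 'a set \<Rightarrow> 'a set" where
  "constants D K = {x \<in> K. D x = 0}"

definition adjoin :: "'a::field_char_0 set \<Rightarrow> 'a \<Rightarrow> 'a set" where
  "adjoin K x = is_subfield hull (insert x K)"

definition algebraic_over :: "'a::field_char_0 set \<Rightarrow> 'a \<Rightarrow> bool" where
  "algebraic_over K x \<longleftrightarrow> (\<exists>p. p \<noteq> 0 \<and> (\<forall>i. coeff p i \<in> K) \<and> poly p x = 0)"

definition is_logarithm :: "('a::field_char_0 \<Rightarrow> 'a) \<Rightarrow> 'a \<Rightarrow> 'a \<Rightarrow> bool" where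
  "is_logarithm D \<theta> \<eta> \<longleftrightarrow> \<eta> \<noteq> 0 \<and> D \<theta> = D \<eta> / \<eta>"

abbreviation is_exponential :: "('a::field_char_0 \<Rightarrow> 'a) \<Rightarrow> 'a \<Rightarrow> 'a \<Rightarrow> bool" where
  "is_exponential D \<eta> \<theta> \<equiv> is_logarithm D \<theta> \<eta>"

definition is_dilogarithm :: "('a::field_char_0 \<Rightarrow> 'a) \<Rightarrow> 'a set \<Rightarrow> 'a \<Rightarrow> 'a \<Rightarrow> bool" where
  "is_dilogarithm D K l g \<longleftrightarrow> g \<in> K - {0, 1} \<and> l \<in> K \<and>
     (\<exists>\<theta>\<in>K. D \<theta> = - (D (1 - g) / (1 - g)) \<and> D l = D g / g * \<theta>)"

text \<open>
  The generators are indexed from 0, so the step from the i-th to the (i+1)-st field of the tower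
  adjoins \<open>\<theta> i\<close>.
\<close>

primrec tower :: "'a::field_char_0 set \<Rightarrow> (nat \<Rightarrow> 'a) \<Rightarrow> nat \<Rightarrow> 'a set" where
  "tower F \<theta> 0 = F"
| "tower F \<theta> (Suc i) = adjoin (tower F \<theta> i) (\<theta> i)"

text \<open>
  In the dilogarithm case the auxiliary logarithm is only required to lie in the field obtained by
  the step, not in the preceding one.
\<close>

definition dilog_elementary_extension ::
  "('a::field_char_0 \<Rightarrow> 'a) \<Rightarrow> 'a set \<Rightarrow> 'a set \<Rightarrow> nat \<Rightarrow> (nat \<Rightarrow> 'a) \<Rightarrow> bool" where
  "dilog_elementary_extension D F E n \<theta> \<longleftrightarrow>
     E = tower F \<theta> n \<and>
     (\<forall>i\<le>n. differential_field D (tower F \<theta> i)) \<and>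
     (\<forall>i<n. algebraic_over (tower F \<theta> i) (\<theta> i)
          \<or> (\<exists>a\<in>tower F \<theta> i. is_exponential D (\<theta> i) a)
          \<or> (\<exists>a\<in>tower F \<theta> i. is_logarithm D (\<theta> i) a)
          \<or> (\<exists>g\<in>tower F \<theta> i - {0, 1}. is_dilogarithm D (tower F \<theta> (Suc i)) (\<theta> i) g))"

definition transcendental_dilog_elementary_extension ::
  "('a::field_char_0 \<Rightarrow> 'a) \<Rightarrow> 'a set \<Rightarrow> 'a set \<Rightarrow> nat \<Rightarrow> (nat \<Rightarrow> 'a) \<Rightarrow> bool" where
  "transcendental_dilog_elementary_extension D F E n \<theta> \<longleftrightarrow>
     dilog_elementary_extension D F E n \<theta> \<and>
     (\<forall>i<n. \<not> algebraic_over (tower F \<theta> i) (\<theta> i))"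

end

theory Submission
  imports Defs
begin

text \<open>
  Descend along the tower one generator at a time. For \<open>L = K(\<theta>)\<close> expand everything at the place
  \<open>\<theta> = \<infinity>\<close>: with \<open>M\<close> its maximal ideal, \<open>L = K[\<theta>] \<oplus> M\<close>, and both summands are stable under the
  derivation. A representation of \<open>f \<in> K\<close> with arguments \<open>g i \<in> L\<close> is replaced by its part of
  degree 0 in \<open>\<theta>\<close>, in which each \<open>g i\<close> leaves only its leading coefficient \<open>l i \<in> K\<close>; no splitting
  field is needed. What is lost in this passage is a multiple of \<open>D \<theta>\<close> (of \<open>D \<theta> / \<theta>\<close> for an
  exponential), and it is restored by one new term or, when \<open>D \<theta>\<close> turns out to be elementary over
  \<open>K\<close>, by finitely many, with a coefficient matrix that stays symmetric. If the auxiliary logarithm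
  \<open>\<phi>\<close> of a dilogarithm \<open>\<theta>\<close> is not in \<open>K\<close>, it is an affine function of \<open>\<theta>\<close>, and \<open>L = K(\<phi>)\<close> is a
  logarithmic extension.
\<close>

section \<open>Subfields, derivations and logarithmic derivatives\<close>

definition dlog :: "('a::field_char_0 \<Rightarrow> 'a) \<Rightarrow> 'a \<Rightarrow> 'a" where
  "dlog D x = D x / x"

locale subfield =
  fixes K :: "'a::field_char_0 set"
  assumes is_subfield: "is_subfield K"
begin

lemma one_mem [simp]: "1 \<in> K"
  and diff_mem [simp]: "x \<in> K \<Longrightarrow> y \<in> K \<Longrightarrow> x - y \<in> K"
  and mult_mem [simp]: "x \<in> K \<Longrightarrow> y \<in> K \<Longrightarrow> x * y \<in> K"
  and inverse_mem [simp]: "x \<in> K \<Longrightarrow> inverse x \<in> K"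
  using is_subfield by (auto simp: is_subfield_def)

lemma zero_mem [simp]: "0 \<in> K"
  using diff_mem[OF one_mem one_mem] by simp

lemma uminus_mem [simp]: "x \<in> K \<Longrightarrow> - x \<in> K"
  using diff_mem[OF zero_mem] by simp

lemma add_mem [simp]: "x \<in> K \<Longrightarrow> y \<in> K \<Longrightarrow> x + y \<in> K"
  using diff_mem[of x "- y"] by simp

lemma divide_mem [simp]: "x \<in> K \<Longrightarrow> y \<in> K \<Longrightarrow> x / y \<in> K"
  by (simp add: divide_inverse)

lemma of_nat_mem [simp]: "of_nat n \<in> K"
  by (induction n) auto

lemma numeral_mem [simp]: "numeral n \<in> K"
  using of_nat_mem[of "numeral n"] by simp

lemma of_int_mem [simp]: "of_int n \<in> K"
  by (cases n) auto

lemma sum_mem [simp]: "(\<And>i. i \<in> I \<Longrightarrow> f i \<in> K) \<Longrightarrow> sum f I \<in> K"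
  by (induction I rule: infinite_finite_induct) auto

end

locale diff_field =
  fixes D :: "'a::field_char_0 \<Rightarrow> 'a" and K :: "'a set"
  assumes differential_field: "differential_field D K"

sublocale diff_field \<subseteq> subfield
  using differential_field by unfold_locales (auto simp: differential_field_def)

context diff_field
begin

lemma D_mem [simp]: "x \<in> K \<Longrightarrow> D x \<in> K"
  and D_add: "x \<in> K \<Longrightarrow> y \<in> K \<Longrightarrow> D (x + y) = D x + D y"
  and D_mult: "x \<in> K \<Longrightarrow> y \<in> K \<Longrightarrow> D (x * y) = D x * y + x * D y"
  using differential_field by (auto simp: differential_field_def)

lemma D_0 [simp]: "D 0 = 0"
  using D_add[of 0 0] by simp

lemma D_1 [simp]: "D 1 = 0"
  using D_mult[of 1 1] by simp

lemma D_uminus: "x \<in> K \<Longrightarrow> D (- x) = - D x"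
  using D_add[of x "- x"] by (simp add: eq_neg_iff_add_eq_0 add.commute)

lemma D_diff: "x \<in> K \<Longrightarrow> y \<in> K \<Longrightarrow> D (x - y) = D x - D y"
  using D_add[of x "- y"] by (simp add: D_uminus)

lemma D_of_nat [simp]: "D (of_nat n) = 0"
  by (induction n) (auto simp: D_add)

lemma D_of_int [simp]: "D (of_int n) = 0"
  by (cases n) (auto simp: D_diff D_uminus D_add simp del: of_nat_Suc)

lemma D_sum: "(\<And>i. i \<in> I \<Longrightarrow> f i \<in> K) \<Longrightarrow> D (sum f I) = (\<Sum>i\<in>I. D (f i))"
  by (induction I rule: infinite_finite_induct) (auto simp: D_add)

lemma D_divide:
  assumes "x \<in> K" "y \<in> K" "y \<noteq> 0"
  shows "D (x / y) = (D x * y - x * D y) / y\<^sup>2"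
proof -
  have "D x = D (x / y * y)" using assms by simp
  also have "\<dots> = D (x / y) * y + x / y * D y" using assms by (intro D_mult) auto
  finally show ?thesis using assms by (simp add: field_simps power2_eq_square)
qed

lemma dlog_mem [simp]: "x \<in> K \<Longrightarrow> dlog D x \<in> K"
  by (simp add: dlog_def)

lemma dlog_1 [simp]: "dlog D 1 = 0"
  by (simp add: dlog_def)

lemma dlog_uminus: "x \<in> K \<Longrightarrow> dlog D (- x) = dlog D x"
  by (simp add: dlog_def D_uminus)

lemma dlog_divide:
  "x \<in> K \<Longrightarrow> y \<in> K \<Longrightarrow> x \<noteq> 0 \<Longrightarrow> y \<noteq> 0 \<Longrightarrow> dlog D (x / y) = dlog D x - dlog D y"
  by (simp add: dlog_def D_divide field_simps power2_eq_square)

abbreviation C where "C \<equiv> constants D K"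

lemma constI: "x \<in> K \<Longrightarrow> D x = 0 \<Longrightarrow> x \<in> C"
  by (auto simp: constants_def)

lemma subfield_C: "is_subfield C"
proof -
  have "D (inverse x) = 0" if "x \<in> K" "D x = 0" for x
    using D_divide[of 1 x] that by (cases "x = 0") (auto simp: inverse_eq_divide)
  then show ?thesis
    unfolding is_subfield_def constants_def by (auto simp: D_diff D_mult)
qed

lemma const_mem [simp]: "x \<in> C \<Longrightarrow> x \<in> K"
  and D_const [simp]: "x \<in> C \<Longrightarrow> D x = 0"
  by (auto simp: constants_def)

lemma D_const_mult: "c \<in> C \<Longrightarrow> x \<in> K \<Longrightarrow> D (c * x) = c * D x"
  by (simp add: D_mult)

sublocale C: subfield C
  using subfield_C by unfold_locales

end

section \<open>The integrability condition and its reduction over the smaller field\<close>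

text \<open>The right-hand side of the theorem, for an arbitrary integrand \<open>f\<close> and a
  variable field \<open>K\<close>: this is the property that is carried down the tower.\<close>

definition dilog_integrable :: "('a::field_char_0 \<Rightarrow> 'a) \<Rightarrow> 'a set \<Rightarrow> 'a \<Rightarrow> bool" where
  "dilog_integrable D K f \<longleftrightarrow>
    (\<exists>(I :: nat set) r g w c cc.
       finite I \<and> (\<forall>i\<in>I. r i \<in> K) \<and> (\<forall>i\<in>I. g i \<in> K - {0, 1}) \<and> w \<in> K \<and>
       (\<forall>i\<in>I. c i \<in> constants D K) \<and>
       (\<forall>i\<in>I. \<forall>j\<in>I. cc i j \<in> constants D K \<and> cc i j = cc j i) \<and>
       f = (\<Sum>i\<in>I. r i * dlog D (g i)) + D w \<and>
       (\<forall>i\<in>I. D (r i) = c i * dlog D (1 - g i) + (\<Sum>j\<in>I. cc i j * dlog D (g j))))"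

context diff_field
begin

lemma dilog_integrableE:
  assumes "dilog_integrable D K f"
  obtains I :: "nat set" and r g w c cc where "finite I" "\<And>i. i \<in> I \<Longrightarrow> r i \<in> K"
    "\<And>i. i \<in> I \<Longrightarrow> g i \<in> K - {0, 1}" "w \<in> K" "\<And>i. i \<in> I \<Longrightarrow> c i \<in> C"
    "\<And>i j. i \<in> I \<Longrightarrow> j \<in> I \<Longrightarrow> cc i j \<in> C \<and> cc i j = cc j i"
    "f = (\<Sum>i\<in>I. r i * dlog D (g i)) + D w"
    "\<And>i. i \<in> I \<Longrightarrow> D (r i) = c i * dlog D (1 - g i) + (\<Sum>j\<in>I. cc i j * dlog D (g j))"
  using assms unfolding dilog_integrable_def
proof (elim exE conjE, goal_cases)
  case (1 I r g w c cc)
  show ?case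
    by (rule that[OF 1(2) bspec[OF 1(3)] bspec[OF 1(4)] 1(5) bspec[OF 1(6)]
          bspec[OF bspec[OF 1(7)]] 1(8) bspec[OF 1(9)]])
qed

text \<open>
  The family may contain terms with \<open>g i = 1\<close>; these contribute nothing,
  so the differential equation for their coefficients is not asked for.
\<close>

lemma dilog_integrableI:
  fixes I :: "'i set"
  assumes fin: "finite I" and r: "\<And>i. i \<in> I \<Longrightarrow> r i \<in> K" and g: "\<And>i. i \<in> I \<Longrightarrow> g i \<in> K - {0}"
    and w: "w \<in> K" and c: "\<And>i. i \<in> I \<Longrightarrow> c i \<in> C"
    and cc: "\<And>i j. i \<in> I \<Longrightarrow> j \<in> I \<Longrightarrow> cc i j \<in> C \<and> cc i j = cc j i"
    and f: "f = (\<Sum>i\<in>I. r i * dlog D (g i)) + D w"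
    and Dr: "\<And>i. i \<in> I \<Longrightarrow> g i \<noteq> 1 \<Longrightarrow>
      D (r i) = c i * dlog D (1 - g i) + (\<Sum>j\<in>I. cc i j * dlog D (g j))"
  shows "dilog_integrable D K f"
proof -
  \<comment> \<open>Drop the arguments equal to 1, whose logarithmic derivative vanishes, and
    renumber the rest by naturals.\<close>
  define J where "J = {i \<in> I. g i \<noteq> 1}"
  have J: "finite J" "J \<subseteq> I" using fin by (auto simp: J_def)
  obtain h where h: "bij_betw h {0..<card J} J"
    using ex_bij_betw_nat_finite J(1) by blast
  have mem: "h n \<in> I" "g (h n) \<noteq> 1" if "n < card J" for n
  proof -
    have "h n \<in> J" using bij_betwE[OF h] that by simp
    then show "h n \<in> I" "g (h n) \<noteq> 1" by (auto simp: J_def)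
  qed
  have sum_eq: "(\<Sum>i\<in>I. q i * dlog D (g i)) = (\<Sum>n\<in>{0..<card J}. q (h n) * dlog D (g (h n)))" for q
  proof -
    have "(\<Sum>i\<in>I. q i * dlog D (g i)) = (\<Sum>i\<in>J. q i * dlog D (g i))"
      by (rule sum.mono_neutral_right) (use fin in \<open>auto simp: J_def\<close>)
    also have "\<dots> = (\<Sum>n\<in>{0..<card J}. q (h n) * dlog D (g (h n)))"
      by (rule sum.reindex_bij_betw[OF h, symmetric])
    finally show ?thesis .
  qed
  show ?thesis
    unfolding dilog_integrable_def
  proof (intro exI conjI ballI)
    show "f = (\<Sum>n\<in>{0..<card J}. r (h n) * dlog D (g (h n))) + D w"
      using f sum_eq by simp
    show "D (r (h n)) = c (h n) * dlog D (1 - g (h n))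
        + (\<Sum>m\<in>{0..<card J}. cc (h n) (h m) * dlog D (g (h m)))" if "n \<in> {0..<card J}" for n
      using Dr[of "h n"] mem[of n] that sum_eq[of "cc (h n)"] by simp
    show "g (h n) \<in> K - {0, 1}" if "n \<in> {0..<card J}" for n
      using g[of "h n"] mem[of n] that by auto
  qed (use w r c cc mem in auto)
qed

text \<open>
  The shape in which an integrand \<open>f\<close> comes down from \<open>K(\<theta>)\<close>, where \<open>b\<close> is the derivative of \<open>\<theta>\<close>,
  or that of the logarithm of \<open>\<theta>\<close> if \<open>\<theta>\<close> is an exponential. The coefficients \<open>B i\<close> and \<open>R\<close> differ
  from combinations of logarithms by constant multiples of an integral of \<open>b\<close>.
\<close>

definition reduced_form where
  "reduced_form b f I A B l c cc \<kappa> R w \<longleftrightarrow>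
     finite I \<and> b \<in> K \<and> \<kappa> \<in> C \<and> R \<in> K \<and> w \<in> K \<and>
     (\<forall>i\<in>I. A i \<in> C \<and> B i \<in> K \<and> l i \<in> K - {0} \<and> c i \<in> C) \<and>
     (\<forall>i\<in>I. \<forall>j\<in>I. cc i j \<in> C \<and> cc i j = cc j i) \<and>
     f = (\<Sum>i\<in>I. B i * dlog D (l i)) + D w + b * R \<and>
     D R = - (\<Sum>i\<in>I. A i * dlog D (l i)) - \<kappa> * b \<and>
     (\<forall>i\<in>I. l i \<noteq> 1 \<longrightarrow>
        D (B i) = c i * dlog D (1 - l i) + (\<Sum>j\<in>I. cc i j * dlog D (l j)) - A i * b)"

text \<open>Formally, \<open>b\<close> integrates to logarithms of the \<open>\<eta> j\<close> plus
  \<open>z\<close>. Shifting \<open>B i\<close> by \<open>A i * z\<close> leaves only logarithmic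
  derivatives in its equation, and new terms with arguments \<open>\<eta> j\<close> and coefficients
  \<open>\<gamma> j * T\<close>, together with the exact part \<open>v\<close>, absorb
  \<open>b * R\<close>. The enlarged matrix is symmetric because \<open>D R\<close> involves the
  same \<open>A i\<close> as the equations for the \<open>B i\<close>, so that both mixed blocks
  consist of the entries \<open>- A i * \<gamma> j\<close>.\<close>

lemma reduced_form_elementary:
  fixes I :: "'i set" and J :: "'j set"
  assumes red: "reduced_form b f I A B l c cc \<kappa> R w" and finJ: "finite J"
    and \<gamma>: "\<And>j. j \<in> J \<Longrightarrow> \<gamma> j \<in> C" and \<eta>: "\<And>j. j \<in> J \<Longrightarrow> \<eta> j \<in> K - {0}" and z: "z \<in> K"
    and b: "b = (\<Sum>j\<in>J. \<gamma> j * dlog D (\<eta> j)) + D z"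
  shows "dilog_integrable D K f"
proof -
  note red' = red[unfolded reduced_form_def]
  have finI: "finite I" and \<kappa>: "\<kappa> \<in> C" and R: "R \<in> K" and w: "w \<in> K"
    and A: "\<And>i. i \<in> I \<Longrightarrow> A i \<in> C" and B: "\<And>i. i \<in> I \<Longrightarrow> B i \<in> K"
    and l: "\<And>i. i \<in> I \<Longrightarrow> l i \<in> K - {0}" and c: "\<And>i. i \<in> I \<Longrightarrow> c i \<in> C"
    and cc: "\<And>i j. i \<in> I \<Longrightarrow> j \<in> I \<Longrightarrow> cc i j \<in> C" "\<And>i j. i \<in> I \<Longrightarrow> j \<in> I \<Longrightarrow> cc i j = cc j i"
    and f: "f = (\<Sum>i\<in>I. B i * dlog D (l i)) + D w + b * R"
    and DR: "D R = - (\<Sum>i\<in>I. A i * dlog D (l i)) - \<kappa> * b"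
    and DB: "\<And>i. i \<in> I \<Longrightarrow> l i \<noteq> 1 \<Longrightarrow>
        D (B i) = c i * dlog D (1 - l i) + (\<Sum>j\<in>I. cc i j * dlog D (l j)) - A i * b"
    using red' by blast+
  define \<beta> where "\<beta> = (\<Sum>j\<in>J. \<gamma> j * dlog D (\<eta> j))"
  define S where "S = (\<Sum>i\<in>I. A i * dlog D (l i))"
  define T where "T = R + \<kappa> * z"
  define r where "r = case_sum (\<lambda>i. B i + A i * z) (\<lambda>j. \<gamma> j * T)"
  define g where "g = case_sum l \<eta>"
  \<comment> \<open>Integration by parts produces \<open>z * T\<close>; the square corrects for the
    difference \<open>\<kappa> * z\<close> between \<open>T\<close> and \<open>R\<close>.\<close>
  define v where "v = w + (z * T - \<kappa> * ((z * z) / 2))"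
  define d where "d = case_sum c (\<lambda>j::'j. 0)"
  define dd where "dd = case_sum (\<lambda>i. case_sum (cc i) (\<lambda>j. - A i * \<gamma> j))
    (\<lambda>j. case_sum (\<lambda>i. - A i * \<gamma> j) (\<lambda>k. - \<kappa> * \<gamma> j * \<gamma> k))"
  note defs = r_def g_def d_def dd_def
  have TK: "T \<in> K" using R \<kappa> z by (simp add: T_def)
  have Dz2: "D (\<kappa> * (z * z / 2)) = \<kappa> * (z * D z)"
  proof -
    have "D (z * z) = 2 * (z * D z)" using z by (simp add: D_mult)
    moreover have "D 2 = 0" using D_of_nat[of 2] by simp
    ultimately have "D (z * z / 2) = z * D z"
      using z by (subst D_divide) (auto simp: power2_eq_square)
    then show ?thesis using D_const_mult[OF \<kappa>, of "z * z / 2"] z by simp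
  qed
  have DT: "D T = - S - \<kappa> * \<beta>"
    unfolding T_def using R \<kappa> z
    by (simp add: D_add D_const_mult DR b S_def \<beta>_def algebra_simps)
  have Dv: "D v = D w + (D z * T + z * D T) - \<kappa> * (z * D z)"
    unfolding v_def using w z TK \<kappa> Dz2 by (simp add: D_add D_diff D_mult[of z T] del: times_divide_eq_right)
  have S': "(\<Sum>i\<in>I. A i * z * dlog D (l i)) = z * S"
    unfolding S_def by (simp add: sum_distrib_left mult_ac)
  have f': "f = (\<Sum>i\<in>I. (B i + A i * z) * dlog D (l i)) + (\<Sum>j\<in>J. \<gamma> j * T * dlog D (\<eta> j)) + D v"
  proof -
    have e1: "(\<Sum>j\<in>J. \<gamma> j * T * dlog D (\<eta> j)) = T * \<beta>"
      unfolding \<beta>_def by (simp add: sum_distrib_left mult_ac)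
    have e2: "(\<Sum>i\<in>I. (B i + A i * z) * dlog D (l i)) = (\<Sum>i\<in>I. B i * dlog D (l i)) + z * S"
      using S' by (simp add: distrib_right sum.distrib)
    have e3: "b = \<beta> + D z" by (simp add: b \<beta>_def)
    show ?thesis
      unfolding e1 e2 Dv DT f e3 by (simp add: T_def algebra_simps)
  qed
  show ?thesis
  proof (rule dilog_integrableI[where I = "I <+> J" and r = r and g = g and w = v and c = d and cc = dd])
    show "finite (I <+> J)" using finI finJ by simp
    show "v \<in> K" using w z TK \<kappa> by (simp add: v_def)
    show "f = (\<Sum>i\<in>I <+> J. r i * dlog D (g i)) + D v"
      using f' finI finJ by (simp add: sum.Plus defs)
    fix x assume x: "x \<in> I <+> J"
    show "r x \<in> K" "g x \<in> K - {0}" "d x \<in> C" using x A B z TK l c \<gamma> \<eta> by (auto simp: defs)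
    show "dd x y \<in> C \<and> dd x y = dd y x" if "y \<in> I <+> J" for y
      using x that cc(1) A \<gamma> \<kappa> by (auto simp: dd_def intro: cc(2))
    assume gx: "g x \<noteq> 1"
    show "D (r x) = d x * dlog D (1 - g x) + (\<Sum>y\<in>I <+> J. dd x y * dlog D (g y))"
    proof (cases x)
      case (Inl i)
      then have i: "i \<in> I" "l i \<noteq> 1" using x gx by (auto simp: defs)
      have "D (r x) = D (B i) + A i * D z"
        using Inl i A B z by (simp add: r_def D_add D_const_mult)
      also have "\<dots> = c i * dlog D (1 - l i) + (\<Sum>j\<in>I. cc i j * dlog D (l j)) - A i * \<beta>"
        using DB[OF i] by (simp add: b \<beta>_def algebra_simps)
      also have "A i * \<beta> = - (\<Sum>j\<in>J. - A i * \<gamma> j * dlog D (\<eta> j))"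
        by (simp add: \<beta>_def sum_distrib_left sum_negf mult_ac)
      finally show ?thesis using Inl finI finJ by (simp add: sum.Plus defs)
    next
      case (Inr j)
      then have j: "j \<in> J" using x by auto
      have "D (r x) = \<gamma> j * (- S - \<kappa> * \<beta>)"
        using Inr j \<gamma> TK by (simp add: r_def D_const_mult DT)
      also have "\<dots> = (\<Sum>i\<in>I. - A i * \<gamma> j * dlog D (l i)) + (\<Sum>k\<in>J. - \<kappa> * \<gamma> j * \<gamma> k * dlog D (\<eta> k))"
        by (simp add: S_def \<beta>_def sum_distrib_left sum_negf algebra_simps)
      finally show ?thesis using Inr finI finJ by (simp add: sum.Plus defs)
    qed
  qed
qed

text \<open>
  If some coefficient \<open>A i\<close> is nonzero, the equation for \<open>B i\<close> makes \<open>\<phi> * dlog D g\<close> elementary over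
  \<open>K\<close>; otherwise \<open>R\<close> is a constant and \<open>g\<close> itself joins the list of arguments.
\<close>

lemma reduced_form_dilog:
  fixes I :: "nat set"
  assumes red: "reduced_form b f I A B l c cc \<kappa> R w"
    and g: "g \<in> K - {0, 1}" and \<phi>: "\<phi> \<in> K" "D \<phi> = - dlog D (1 - g)"
    and b: "b = dlog D g * \<phi>"
    and new: "\<And>z k. z \<in> K \<Longrightarrow> k \<in> C \<Longrightarrow> D z = k * b \<Longrightarrow> k = 0"
  shows "dilog_integrable D K f"
proof -
  note red' = red[unfolded reduced_form_def]
  have finI: "finite I" and \<kappa>: "\<kappa> \<in> C" and R: "R \<in> K" and w: "w \<in> K"
    and A: "\<And>i. i \<in> I \<Longrightarrow> A i \<in> C" and B: "\<And>i. i \<in> I \<Longrightarrow> B i \<in> K"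
    and l: "\<And>i. i \<in> I \<Longrightarrow> l i \<in> K - {0}" and c: "\<And>i. i \<in> I \<Longrightarrow> c i \<in> C"
    and cc: "\<And>i j. i \<in> I \<Longrightarrow> j \<in> I \<Longrightarrow> cc i j \<in> C" "\<And>i j. i \<in> I \<Longrightarrow> j \<in> I \<Longrightarrow> cc i j = cc j i"
    and f: "f = (\<Sum>i\<in>I. B i * dlog D (l i)) + D w + b * R"
    and DR: "D R = - (\<Sum>i\<in>I. A i * dlog D (l i)) - \<kappa> * b"
    and DB: "\<And>i. i \<in> I \<Longrightarrow> l i \<noteq> 1 \<Longrightarrow>
        D (B i) = c i * dlog D (1 - l i) + (\<Sum>j\<in>I. cc i j * dlog D (l j)) - A i * b"
    using red' by blast+
  show ?thesis
  proof (cases "\<exists>i\<in>I. l i \<noteq> 1 \<and> A i \<noteq> 0")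
    case True
    then obtain i where i: "i \<in> I" "l i \<noteq> 1" "A i \<noteq> 0" by blast
    \<comment> \<open>Solve the equation for \<open>B i\<close> for \<open>b\<close>. The fresh
      index \<open>k\<close> carries the argument \<open>1 - l i\<close>, the indices in
      \<open>I\<close> keep their \<open>l j\<close>, and the exact part is the derivative of
      \<open>- B i / A i\<close>.\<close>
    obtain k where k: "k \<notin> I" using finI ex_new_if_finite infinite_UNIV_nat by blast
    define \<gamma> where "\<gamma> j = (if j = k then c i else cc i j) / A i" for j
    define \<eta> where "\<eta> j = (if j = k then 1 - l i else l j)" for j
    have Dz: "D (- (1 / A i) * B i) = - D (B i) / A i"
      using i A B by (subst D_const_mult) auto
    have sum_eq: "(\<Sum>j\<in>insert k I. \<gamma> j * dlog D (\<eta> j)) =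
        c i / A i * dlog D (1 - l i) + (\<Sum>j\<in>I. cc i j * dlog D (l j)) / A i"
    proof -
      have "(\<Sum>j\<in>I. \<gamma> j * dlog D (\<eta> j)) = (\<Sum>j\<in>I. cc i j * dlog D (l j)) / A i"
        unfolding sum_divide_distrib using k by (intro sum.cong) (auto simp: \<gamma>_def \<eta>_def)
      then show ?thesis using finI k by (simp add: \<gamma>_def \<eta>_def)
    qed
    show ?thesis
    proof (rule reduced_form_elementary[OF red, where J = "insert k I" and \<gamma> = \<gamma> and \<eta> = \<eta>
          and z = "- (1 / A i) * B i"])
      show "b = (\<Sum>j\<in>insert k I. \<gamma> j * dlog D (\<eta> j)) + D (- (1 / A i) * B i)"
        unfolding sum_eq Dz using DB[OF i(1,2)] i(3) by (simp add: diff_divide_distrib add_divide_distrib)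
    qed (use i A B l c cc(1) finI in \<open>auto simp: \<gamma>_def \<eta>_def\<close>)
  next
    case False
    then have A0: "A i = 0" if "i \<in> I" "l i \<noteq> 1" for i using that by blast
    have "(\<Sum>i\<in>I. A i * dlog D (l i)) = 0"
    proof (intro sum.neutral ballI)
      show "A i * dlog D (l i) = 0" if "i \<in> I" for i using A0[OF that] by (cases "l i = 1") auto
    qed
    then have "D R = - \<kappa> * b" using DR by simp
    \<comment> \<open>A nonzero \<open>\<kappa>\<close> is excluded by \<open>new\<close>, so
      \<open>R\<close> is a constant.\<close>
    then have "D R = 0" using new[OF R, of "- \<kappa>"] \<kappa> by auto
    then have RC: "R \<in> C" using R constI by blast
    \<comment> \<open>\<open>None\<close> indexes the new term: \<open>b * R\<close> is
      \<open>R * \<phi>\<close> times \<open>dlog D g\<close>, and \<open>R * \<phi>\<close> has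
      derivative \<open>- R * dlog D (1 - g)\<close>, so its row and column in the matrix are
      zero.\<close>
    define r where "r = case_option (R * \<phi>) B"
    define h where "h = case_option g l"
    define d where "d = case_option (- R) c"
    define dd where "dd = case_option (\<lambda>_. 0) (\<lambda>i. case_option 0 (cc i))"
    note defs = r_def h_def d_def dd_def
    have sum_eq: "(\<Sum>x\<in>insert None (Some ` I). q x) = q None + (\<Sum>i\<in>I. q (Some i))"
      for q :: "nat option \<Rightarrow> 'a"
      using finI by (simp add: sum.reindex)
    show ?thesis
    proof (rule dilog_integrableI[where I = "insert None (Some ` I)" and r = r and g = h and w = w
          and c = d and cc = dd])
      show "f = (\<Sum>x\<in>insert None (Some ` I). r x * dlog D (h x)) + D w"
        unfolding sum_eq by (simp add: defs f b)
      fix x assume x: "x \<in> insert None (Some ` I)"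
      show "r x \<in> K" "h x \<in> K - {0}" "d x \<in> C" using x R RC \<phi> g B c l by (auto simp: defs)
      show "dd x y \<in> C \<and> dd x y = dd y x" if "y \<in> insert None (Some ` I)" for y
        using x that cc(1) by (auto simp: dd_def intro: cc(2))
      assume hx: "h x \<noteq> 1"
      show "D (r x) = d x * dlog D (1 - h x) + (\<Sum>y\<in>insert None (Some ` I). dd x y * dlog D (h y))"
      proof (cases x)
        case None
        then show ?thesis
          unfolding sum_eq using RC \<phi> by (simp add: defs D_const_mult)
      next
        case (Some i)
        then have "i \<in> I" "l i \<noteq> 1" using x hx by (auto simp: defs)
        then show ?thesis
          unfolding sum_eq using Some DB[of i] A0[of i] by (simp add: defs)
      qed
    qed (use finI w in auto)
  qed
qed

end

section \<open>Polynomials with coefficients in a subfield\<close>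

definition polys_over :: "'a::zero set \<Rightarrow> 'a poly set" where
  "polys_over K = {p. \<forall>i. coeff p i \<in> K}"

context subfield
begin

lemma pCons_polys_over [simp]: "pCons a p \<in> polys_over K \<longleftrightarrow> a \<in> K \<and> p \<in> polys_over K"
  unfolding polys_over_def by (auto simp: coeff_pCons split: nat.splits)

lemma zero_polys_over [simp]: "0 \<in> polys_over K"
  and one_polys_over [simp]: "1 \<in> polys_over K"
  and add_polys_over [simp]: "p \<in> polys_over K \<Longrightarrow> q \<in> polys_over K \<Longrightarrow> p + q \<in> polys_over K"
  and diff_polys_over [simp]: "p \<in> polys_over K \<Longrightarrow> q \<in> polys_over K \<Longrightarrow> p - q \<in> polys_over K"
  and smult_polys_over [simp]: "c \<in> K \<Longrightarrow> p \<in> polys_over K \<Longrightarrow> smult c p \<in> polys_over K"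
  and monom_polys_over [simp]: "c \<in> K \<Longrightarrow> monom c n \<in> polys_over K"
  and mult_polys_over [simp]: "p \<in> polys_over K \<Longrightarrow> q \<in> polys_over K \<Longrightarrow> p * q \<in> polys_over K"
  and pderiv_polys_over [simp]: "p \<in> polys_over K \<Longrightarrow> pderiv p \<in> polys_over K"
  by (auto simp: polys_over_def coeff_mult coeff_pderiv simp del: of_nat_Suc)

end

lemma coeff_polys_over [simp]: "p \<in> polys_over K \<Longrightarrow> coeff p i \<in> K"
  by (simp add: polys_over_def)

context subfield
begin

lemma pcompose_polys_over [simp]:
  assumes "p \<in> polys_over K" "q \<in> polys_over K"
  shows "pcompose p q \<in> polys_over K"
  using assms(1) by (induction p) (auto simp: pcompose_pCons assms(2))

lemma poly_mem [simp]: "p \<in> polys_over K \<Longrightarrow> x \<in> K \<Longrightarrow> poly p x \<in> K"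
  by (induction p) auto

text \<open>Each step of long division divides only by the leading coefficient of \<open>q\<close>,
  so no coefficient leaves \<open>K\<close>.\<close>

lemma polys_over_division:
  assumes "p \<in> polys_over K" "q \<in> polys_over K" "q \<noteq> 0"
  shows "\<exists>s\<in>polys_over K. \<exists>r\<in>polys_over K. p = q * s + r \<and> (r = 0 \<or> degree r < degree q)"
  using assms(1)
proof (induction "degree p" arbitrary: p rule: less_induct)
  case less
  show ?case
  proof (cases "p = 0 \<or> degree p < degree q")
    case True
    then show ?thesis using less.prems by (intro bexI[of _ 0] bexI[of _ p]) auto
  next
    case False
    define t where "t = monom (lead_coeff p / lead_coeff q) (degree p - degree q)"
    define p' where "p' = p - q * t"
    have t: "t \<in> polys_over K" and p': "p' \<in> polys_over K"
      using less.prems assms(2) by (auto simp: t_def p'_def)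
    have t0: "t \<noteq> 0" "degree t = degree p - degree q"
      using False assms(3) by (auto simp: t_def monom_eq_0_iff degree_monom_eq)
    have deg_le: "degree p' \<le> degree p"
      unfolding p'_def using False t0 assms(3) by (intro degree_diff_le) (auto simp: degree_mult_eq)
    have "coeff (q * t) (degree q + degree t) = lead_coeff q * lead_coeff t"
      by (rule coeff_mult_degree_sum)
    then have "coeff p' (degree p) = 0"
      using False assms(3) t0 by (simp add: p'_def t_def degree_monom_eq)
    then have "p' = 0 \<or> degree p' < degree p"
      using deg_le eq_zero_or_degree_less by blast
    then show ?thesis
    proof
      assume "p' = 0"
      then show ?thesis using t by (intro bexI[of _ t] bexI[of _ 0]) (auto simp: p'_def)
    next
      assume "degree p' < degree p"
      from less.hyps[OF this p'] obtain s r where s: "s \<in> polys_over K" "r \<in> polys_over K"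
        "p' = q * s + r" "r = 0 \<or> degree r < degree q" by blast
      then have "p = q * (s + t) + r" by (simp add: p'_def algebra_simps)
      then show ?thesis using s t by (intro bexI[of _ "s + t"] bexI[of _ r]) auto
    qed
  qed
qed

end

context diff_field
begin

lemma map_poly_D_polys_over [simp]: "p \<in> polys_over K \<Longrightarrow> map_poly D p \<in> polys_over K"
  unfolding polys_over_def by (auto simp: coeff_map_poly)

lemma degree_map_poly_D: "degree (map_poly D p) \<le> degree p"
  by (intro degree_le) (auto simp: coeff_map_poly coeff_eq_0)

end

section \<open>Simple transcendental extensions without new constants\<close>

locale simple_transcendental_extension = K: diff_field D K + L: diff_field D L
  for D :: "'a::field_char_0 \<Rightarrow> 'a" and K L :: "'a set" +
  fixes \<theta> :: 'a
  assumes L_eq: "L = adjoin K \<theta>"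
    and transcendental: "\<not> algebraic_over K \<theta>"
    and constants_eq: "constants D L = constants D K"
begin

abbreviation P where "P \<equiv> polys_over K"

lemma K_sub_L [simp]: "x \<in> K \<Longrightarrow> x \<in> L"
  and \<theta>_mem [simp]: "\<theta> \<in> L"
  unfolding L_eq adjoin_def by (auto intro: hull_inc)

lemma P_sub [simp]: "p \<in> P \<Longrightarrow> p \<in> polys_over L"
  unfolding polys_over_def by auto

lemma poly_\<theta>_eq_0_iff [simp]: "p \<in> P \<Longrightarrow> poly p \<theta> = 0 \<longleftrightarrow> p = 0"
  using transcendental unfolding algebraic_over_def polys_over_def by auto

lemma poly_\<theta>_eq_iff: "p \<in> P \<Longrightarrow> q \<in> P \<Longrightarrow> poly p \<theta> = poly q \<theta> \<longleftrightarrow> p = q"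
  using poly_\<theta>_eq_0_iff[of "p - q"] by simp

lemma \<theta>_not_mem: "\<theta> \<notin> K"
  using poly_\<theta>_eq_0_iff[of "[:- \<theta>, 1:]"] by auto

lemma const_L_mem: "x \<in> L \<Longrightarrow> D x = 0 \<Longrightarrow> x \<in> K.C"
  using constants_eq L.constI by blast

lemma const_mult_\<theta>_mem: "c \<in> K \<Longrightarrow> c * \<theta> \<in> K \<Longrightarrow> c = 0"
  using K.divide_mem[of "c * \<theta>" c] \<theta>_not_mem by (cases "c = 0") simp_all

text \<open>The quotients form a subfield containing \<open>K\<close> and \<open>\<theta>\<close>,
  and \<open>adjoin\<close> is the least such subfield.\<close>

lemma fraction:
  assumes "x \<in> L"
  shows "\<exists>p\<in>P. \<exists>q\<in>P. q \<noteq> 0 \<and> x = poly p \<theta> / poly q \<theta>"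
proof -
  define S where "S = {x. \<exists>p\<in>P. \<exists>q\<in>P. q \<noteq> 0 \<and> x = poly p \<theta> / poly q \<theta>}"
  have SI: "x \<in> S" if "p \<in> P" "q \<in> P" "q \<noteq> 0" "x = poly p \<theta> / poly q \<theta>" for x p q
    using that unfolding S_def by blast
  have "is_subfield S"
    unfolding is_subfield_def
  proof (intro conjI ballI)
    show "1 \<in> S" by (rule SI[of 1 1]) auto
  next
    fix x y assume "x \<in> S" "y \<in> S"
    then obtain p q p' q' where xy: "p \<in> P" "q \<in> P" "q \<noteq> 0" "x = poly p \<theta> / poly q \<theta>"
      "p' \<in> P" "q' \<in> P" "q' \<noteq> 0" "y = poly p' \<theta> / poly q' \<theta>"
      unfolding S_def by blast
    show "x - y \<in> S" by (rule SI[of "p * q' - p' * q" "q * q'"]) (use xy in \<open>auto simp: diff_frac_eq\<close>)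
    show "x * y \<in> S" by (rule SI[of "p * p'" "q * q'"]) (use xy in auto)
  next
    fix x assume "x \<in> S"
    then obtain p q where x: "p \<in> P" "q \<in> P" "q \<noteq> 0" "x = poly p \<theta> / poly q \<theta>"
      unfolding S_def by blast
    show "inverse x \<in> S"
    proof (cases "p = 0")
      case True
      then show ?thesis using x by (intro SI[of 0 1]) auto
    next
      case False
      then show ?thesis using x by (intro SI[of q p]) auto
    qed
  qed
  moreover have "insert \<theta> K \<subseteq> S"
    by (auto intro: SI[of "[:_:]" 1] SI[of "[:0, 1:]" 1])
  ultimately have "L \<subseteq> S" unfolding L_eq adjoin_def by (intro hull_minimal)
  then show ?thesis using assms unfolding S_def by blast
qed

lemma D_poly:
  "p \<in> P \<Longrightarrow> D (poly p \<theta>) = poly (map_poly D p) \<theta> + poly (pderiv p) \<theta> * D \<theta>"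
proof (induction p)
  case (pCons a p)
  then have "a \<in> K" "p \<in> P" by auto
  then show ?case
    using pCons by (simp add: L.D_add L.D_mult map_poly_pCons pderiv_pCons algebra_simps)
qed simp

end

section \<open>Extensions whose generator has an affine derivative\<close>

text \<open>
  Covers primitives (\<open>e = 0\<close>) and exponentials (\<open>b = 0\<close>) at once.
\<close>

locale affine_extension = simple_transcendental_extension +
  fixes e b :: 'a
  assumes e_mem [simp]: "e \<in> K" and b_mem [simp]: "b \<in> K" and D_\<theta>: "D \<theta> = e * \<theta> + b"
begin

text \<open>The derivation of the polynomial ring that extends \<open>D\<close> on \<open>K\<close>
  and sends the indeterminate X to \<open>e\<close> X + \<open>b\<close>; evaluation at
  \<open>\<theta>\<close> turns it into \<open>D\<close>.\<close>

definition poly_D :: "'a poly \<Rightarrow> 'a poly" where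
  "poly_D p = map_poly D p + pderiv p * [:b, e:]"

lemma poly_D_mem [simp]: "p \<in> P \<Longrightarrow> poly_D p \<in> P"
  by (simp add: poly_D_def)

lemma D_poly_\<theta>: "p \<in> P \<Longrightarrow> D (poly p \<theta>) = poly (poly_D p) \<theta>"
  by (simp add: D_poly poly_D_def D_\<theta> algebra_simps)

lemma coeff_poly_D: "coeff (poly_D p) n =
    D (coeff p n) + of_nat (Suc n) * b * coeff p (Suc n) + of_nat n * e * coeff p n"
  unfolding poly_D_def
  by (cases n) (simp_all add: coeff_map_poly coeff_pderiv algebra_simps)

text \<open>The derivative of the indeterminate has degree at most 1, so differentiating cannot
  raise degrees. This is what makes \<open>M\<close> stable under \<open>D\<close>.\<close>

lemma degree_poly_D: "degree (poly_D p) \<le> degree p"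
  by (intro degree_le) (auto simp: coeff_poly_D coeff_eq_0)

section \<open>The place at infinity and congruence modulo its maximal ideal\<close>

text \<open>
  \<open>M\<close> is the maximal ideal of the place of \<open>K(\<theta>)\<close> at \<open>\<theta> = \<infinity>\<close>; \<open>K(\<theta>)\<close> is the direct sum of
  \<open>K[\<theta>]\<close> and \<open>M\<close>, and the derivation respects this decomposition.
\<close>

definition M :: "'a set" where
  "M = {poly p \<theta> / poly q \<theta> | p q. p \<in> P \<and> q \<in> P \<and> degree p < degree q}"

text \<open>On \<open>L\<close> this says that the polynomial parts in \<open>\<theta>\<close>
  agree. It respects sums, \<open>D\<close> and factors from \<open>K\<close>, but not
  multiplication by \<open>\<theta>\<close>, since \<open>M\<close> is an ideal of the valuation
  ring and not of \<open>L\<close>.\<close>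

definition congM (infix \<open>\<approx>\<close> 50) where
  "x \<approx> y \<longleftrightarrow> x - y \<in> M"

lemma MI: "p \<in> P \<Longrightarrow> q \<in> P \<Longrightarrow> degree p < degree q \<Longrightarrow> poly p \<theta> / poly q \<theta> \<in> M"
  unfolding M_def by blast

lemma ME:
  assumes "x \<in> M"
  obtains p q where "p \<in> P" "q \<in> P" "degree p < degree q" "q \<noteq> 0" "poly q \<theta> \<noteq> 0"
    "x = poly p \<theta> / poly q \<theta>"
proof -
  obtain p q where pq: "p \<in> P" "q \<in> P" "degree p < degree q" "x = poly p \<theta> / poly q \<theta>"
    using assms unfolding M_def by blast
  then have "q \<noteq> 0" by auto
  with pq show ?thesis by (intro that[of p q]) auto
qed

lemma M_sub_L [simp]: "x \<in> M \<Longrightarrow> x \<in> L"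
  by (erule ME) simp

lemma zero_M [simp]: "0 \<in> M"
  using MI[of 0 "[:0, 1:]"] by simp

lemma add_M [simp]:
  assumes "x \<in> M" "y \<in> M"
  shows "x + y \<in> M"
proof -
  obtain p q where x: "p \<in> P" "q \<in> P" "degree p < degree q" "q \<noteq> 0" "poly q \<theta> \<noteq> 0"
    "x = poly p \<theta> / poly q \<theta>" using assms(1) by (rule ME)
  obtain p' q' where y: "p' \<in> P" "q' \<in> P" "degree p' < degree q'" "q' \<noteq> 0" "poly q' \<theta> \<noteq> 0"
    "y = poly p' \<theta> / poly q' \<theta>" using assms(2) by (rule ME)
  have "degree (p * q' + p' * q) < degree (q * q')"
    using x y degree_mult_le[of p q'] degree_mult_le[of p' q]
    by (intro degree_add_less) (auto simp: degree_mult_eq)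
  then have "poly (p * q' + p' * q) \<theta> / poly (q * q') \<theta> \<in> M"
    using x y by (intro MI) auto
  then show ?thesis using x y by (simp add: add_frac_eq)
qed

lemma mult_M [simp]:
  assumes "x \<in> M" "y \<in> M"
  shows "x * y \<in> M"
proof -
  obtain p q where x: "p \<in> P" "q \<in> P" "degree p < degree q" "q \<noteq> 0" "poly q \<theta> \<noteq> 0"
    "x = poly p \<theta> / poly q \<theta>" using assms(1) by (rule ME)
  obtain p' q' where y: "p' \<in> P" "q' \<in> P" "degree p' < degree q'" "q' \<noteq> 0" "poly q' \<theta> \<noteq> 0"
    "y = poly p' \<theta> / poly q' \<theta>" using assms(2) by (rule ME)
  have "degree (p * p') < degree (q * q')"
    using x y degree_mult_le[of p p'] by (auto simp: degree_mult_eq)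
  then have "poly (p * p') \<theta> / poly (q * q') \<theta> \<in> M"
    using x y by (intro MI) auto
  then show ?thesis using x y by simp
qed

lemma K_mult_M [simp]:
  assumes "k \<in> K" "x \<in> M"
  shows "k * x \<in> M"
proof -
  obtain p q where x: "p \<in> P" "q \<in> P" "degree p < degree q" "q \<noteq> 0" "poly q \<theta> \<noteq> 0"
    "x = poly p \<theta> / poly q \<theta>" using assms(2) by (rule ME)
  have "poly (smult k p) \<theta> / poly q \<theta> \<in> M"
    using x assms(1) degree_smult_le[of k p] by (intro MI) auto
  then show ?thesis using x by simp
qed

lemma uminus_M [simp]: "x \<in> M \<Longrightarrow> - x \<in> M"
  using K_mult_M[of "-1" x] by simp

lemma diff_M [simp]: "x \<in> M \<Longrightarrow> y \<in> M \<Longrightarrow> x - y \<in> M"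
  using add_M[of x "- y"] by simp

lemma sum_M: "(\<And>i. i \<in> I \<Longrightarrow> f i \<in> M) \<Longrightarrow> sum f I \<in> M"
  by (induction I rule: infinite_finite_induct) auto

lemma D_M [simp]:
  assumes "x \<in> M"
  shows "D x \<in> M"
proof -
  obtain p q where x: "p \<in> P" "q \<in> P" "degree p < degree q" "q \<noteq> 0" "poly q \<theta> \<noteq> 0"
    "x = poly p \<theta> / poly q \<theta>" using assms by (rule ME)
  have "degree (poly_D p * q - p * poly_D q) < degree (q * q)"
    using x degree_mult_le[of "poly_D p" q] degree_mult_le[of p "poly_D q"]
      degree_poly_D[of p] degree_poly_D[of q]
    by (intro degree_diff_less) (auto simp: degree_mult_eq)
  then have "poly (poly_D p * q - p * poly_D q) \<theta> / poly (q * q) \<theta> \<in> M"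
    using x by (intro MI) auto
  then show ?thesis using x by (simp add: L.D_divide D_poly_\<theta> power2_eq_square)
qed

lemma congM_refl [simp]: "x \<approx> x"
  by (simp add: congM_def)

lemma congM_sym: "x \<approx> y \<Longrightarrow> y \<approx> x"
  unfolding congM_def using uminus_M[of "x - y"] by simp

lemma congM_trans [trans]: "x \<approx> y \<Longrightarrow> y \<approx> z \<Longrightarrow> x \<approx> z"
  unfolding congM_def using add_M[of "x - y" "y - z"] by simp

lemma congM_add: "x \<approx> y \<Longrightarrow> x' \<approx> y' \<Longrightarrow> x + x' \<approx> y + y'"
  unfolding congM_def using add_M[of "x - y" "x' - y'"] by (simp add: algebra_simps)

lemma congM_diff: "x \<approx> y \<Longrightarrow> x' \<approx> y' \<Longrightarrow> x - x' \<approx> y - y'"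
  unfolding congM_def using diff_M[of "x - y" "x' - y'"] by (simp add: algebra_simps)

lemma congM_sum: "(\<And>i. i \<in> I \<Longrightarrow> f i \<approx> g i) \<Longrightarrow> sum f I \<approx> sum g I"
  unfolding congM_def by (simp add: sum_M flip: sum_subtractf)

lemma congM_K_mult: "k \<in> K \<Longrightarrow> x \<approx> y \<Longrightarrow> k * x \<approx> k * y"
  unfolding congM_def using K_mult_M[of k "x - y"] by (simp add: algebra_simps)

lemma congM_D: "x \<in> L \<Longrightarrow> y \<in> L \<Longrightarrow> x \<approx> y \<Longrightarrow> D x \<approx> D y"
  unfolding congM_def using D_M[of "x - y"] by (simp add: L.D_diff)

text \<open>The sum of polynomials and \<open>M\<close> is direct: clearing the denominator gives
  \<open>s * q = p\<close> with \<open>degree p < degree q\<close>, which forces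
  \<open>s = 0\<close>.\<close>

lemma poly_M_iff: "s \<in> P \<Longrightarrow> poly s \<theta> \<in> M \<longleftrightarrow> s = 0"
proof
  assume s: "s \<in> P" "poly s \<theta> \<in> M"
  from s(2) obtain p q where x: "p \<in> P" "q \<in> P" "degree p < degree q" "q \<noteq> 0" "poly q \<theta> \<noteq> 0"
    "poly s \<theta> = poly p \<theta> / poly q \<theta>" by (rule ME)
  then have "poly (s * q) \<theta> = poly p \<theta>" by (simp add: field_simps)
  then have "s * q = p" using x s by (simp add: poly_\<theta>_eq_iff del: poly_mult)
  then show "s = 0" using x by (metis degree_mult_eq le_add2 linorder_not_le)
qed auto

lemma congM_poly_iff: "s \<in> P \<Longrightarrow> t \<in> P \<Longrightarrow> poly s \<theta> \<approx> poly t \<theta> \<longleftrightarrow> s = t"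
  unfolding congM_def using poly_M_iff[of "s - t"] by simp

text \<open>Divide the numerator by the denominator; the remainder contributes an element of
  \<open>M\<close>.\<close>

lemma polynomial_part:
  assumes "x \<in> L"
  obtains s where "s \<in> P" "x \<approx> poly s \<theta>"
proof -
  obtain p q where x: "p \<in> P" "q \<in> P" "q \<noteq> 0" "x = poly p \<theta> / poly q \<theta>"
    using fraction[OF assms] by blast
  obtain s r where sr: "s \<in> P" "r \<in> P" "p = q * s + r" "r = 0 \<or> degree r < degree q"
    using K.polys_over_division[OF x(1-3)] by blast
  have "x - poly s \<theta> = poly r \<theta> / poly q \<theta>" using x sr by (simp add: field_simps)
  also have "\<dots> \<in> M" using sr x by (auto intro: MI)
  finally show ?thesis using sr that by (simp add: congM_def)
qed

text \<open>The residue at infinity. It is read off at \<open>degree q\<close> rather than at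
  \<open>degree p\<close>, so that it is 0 when the numerator has smaller degree.\<close>

lemma congM_fraction:
  assumes "p \<in> P" "q \<in> P" "q \<noteq> 0" "degree p \<le> degree q"
  shows "poly p \<theta> / poly q \<theta> \<approx> coeff p (degree q) / lead_coeff q"
proof -
  define k where "k = coeff p (degree q) / lead_coeff q"
  define r where "r = p - smult k q"
  have k: "k \<in> K" and r: "r \<in> P" using assms by (auto simp: k_def r_def)
  have "degree r \<le> degree q" using assms unfolding r_def by (intro degree_diff_le) auto
  moreover have "coeff r (degree q) = 0" using assms by (simp add: r_def k_def)
  ultimately have "r = 0 \<or> degree r < degree q" using eq_zero_or_degree_less by blast
  then have "poly r \<theta> / poly q \<theta> \<in> M" using r assms by (auto intro: MI)
  moreover have "poly p \<theta> / poly q \<theta> - k = poly r \<theta> / poly q \<theta>"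
    using assms by (simp add: r_def field_simps)
  ultimately show ?thesis by (simp add: congM_def k_def)
qed

section \<open>Expansion of logarithmic derivatives at infinity\<close>

lemma dlog_poly:
  assumes "p \<in> P" "p \<noteq> 0"
  shows "dlog D (poly p \<theta>) \<approx> dlog D (lead_coeff p) + of_nat (degree p) * e"
proof -
  have "poly (poly_D p) \<theta> / poly p \<theta> \<approx> coeff (poly_D p) (degree p) / lead_coeff p"
    using assms degree_poly_D by (intro congM_fraction) auto
  also have "coeff (poly_D p) (degree p) / lead_coeff p =
      dlog D (lead_coeff p) + of_nat (degree p) * e"
    using assms by (simp add: coeff_poly_D coeff_eq_0 dlog_def field_simps)
  finally show ?thesis using assms by (simp add: dlog_def D_poly_\<theta>)
qed

text \<open>The coefficient of \<open>1 / \<theta>\<close> in the expansion. It matters for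
  primitives, where a coefficient \<open>r i\<close> may have degree 1 in \<open>\<theta>\<close>.
  Here \<open>\<alpha>\<close> is the second coefficient of \<open>p\<close> divided by the leading
  one, and 0 in degree 0.\<close>

lemma dlog_poly_second_order:
  assumes "p \<in> P" "p \<noteq> 0"
  shows "\<exists>\<alpha>\<in>K. \<theta> * (dlog D (poly p \<theta>) - (dlog D (lead_coeff p) + of_nat (degree p) * e))
    \<approx> of_nat (degree p) * b + D \<alpha> - e * \<alpha>"
proof -
  define n where "n = degree p"
  define a where "a = lead_coeff p"
  define k where "k = dlog D a + of_nat n * e"
  \<comment> \<open>The numerator left after subtracting the residue has degree below
    \<open>n\<close>; multiplied by \<open>\<theta>\<close>, it becomes \<open>pCons 0 N\<close> and
    has a residue of its own.\<close>
  define N where "N = poly_D p - smult k p"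
  have a: "a \<in> K" "a \<noteq> 0" using assms by (auto simp: a_def)
  have k: "k \<in> K" using a by (simp add: k_def)
  have N: "N \<in> P" using assms k by (simp add: N_def)
  have "coeff N i = 0" if "i \<ge> n" for i
  proof (cases "i = n")
    case True
    then show ?thesis
      using assms a by (simp add: N_def coeff_poly_D n_def coeff_eq_0 k_def dlog_def a_def field_simps)
  next
    case False
    then show ?thesis using that by (simp add: N_def coeff_poly_D n_def coeff_eq_0)
  qed
  then have "degree (pCons 0 N) \<le> n"
    by (intro degree_le) (auto simp: coeff_pCons split: nat.splits)
  then have "poly (pCons 0 N) \<theta> / poly p \<theta> \<approx> coeff (pCons 0 N) (degree p) / lead_coeff p"
    using assms N by (intro congM_fraction) (auto simp: n_def)
  moreover have "poly (pCons 0 N) \<theta> / poly p \<theta> = \<theta> * (dlog D (poly p \<theta>) - k)"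
    using assms by (simp add: N_def dlog_def D_poly_\<theta> field_simps)
  ultimately have cong: "\<theta> * (dlog D (poly p \<theta>) - k) \<approx> coeff (pCons 0 N) n / a"
    by (simp add: n_def a_def)
  have "\<exists>\<alpha>\<in>K. coeff (pCons 0 N) n / a = of_nat n * b + D \<alpha> - e * \<alpha>"
  proof (cases n)
    case 0
    then show ?thesis by (intro bexI[of _ 0]) auto
  next
    case (Suc m)
    define \<alpha> where "\<alpha> = coeff p m / a"
    have am: "coeff p (Suc m) = a" using Suc by (simp add: a_def n_def)
    have "D \<alpha> = D (coeff p m) / a - \<alpha> * dlog D a"
      using a assms by (simp add: \<alpha>_def K.D_divide dlog_def power2_eq_square field_simps)
    then have "coeff (pCons 0 N) n / a = of_nat n * b + D \<alpha> - e * \<alpha>"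
      using a am by (simp add: Suc N_def coeff_poly_D k_def \<alpha>_def field_simps)
    then show ?thesis using a assms by (intro bexI[of _ \<alpha>]) (auto simp: \<alpha>_def)
  qed
  then show ?thesis using cong by (auto simp: k_def n_def a_def)
qed

text \<open>
  Only the leading coefficient of \<open>1 - g\<close> at infinity when \<open>g\<close> reduces to 1 there is left unknown,
  and then \<open>dlog D l\<close> vanishes.
\<close>

lemma leading_term:
  assumes g: "g \<in> L" "g \<noteq> 0" "g \<noteq> 1"
  obtains l m \<alpha> \<sigma> where "l \<in> K - {0}" "\<alpha> \<in> K" "\<sigma> \<in> K"
    "dlog D g \<approx> dlog D l + of_int m * e"
    "\<theta> * (dlog D g - (dlog D l + of_int m * e)) \<approx> of_int m * b + D \<alpha> - e * \<alpha>"
    "dlog D (1 - g) \<approx> \<sigma>"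
    "m > 0 \<Longrightarrow> \<sigma> = dlog D l + of_int m * e" "m < 0 \<Longrightarrow> \<sigma> = 0"
    "m = 0 \<Longrightarrow> l \<noteq> 1 \<Longrightarrow> \<sigma> = dlog D (1 - l)"
proof -
  obtain p q where pq: "p \<in> P" "q \<in> P" "q \<noteq> 0" "g = poly p \<theta> / poly q \<theta>"
    using fraction[OF g(1)] by blast
  define s where "s = q - p"
  have "p \<noteq> 0" using pq g by auto
  have s: "s \<in> P" using pq by (simp add: s_def)
  have "s \<noteq> 0" using pq g by (auto simp: s_def)
  have g1: "1 - g = poly s \<theta> / poly q \<theta>" using pq by (simp add: s_def diff_divide_distrib)
  define lp lq ls where "lp = lead_coeff p" and "lq = lead_coeff q" and "ls = lead_coeff s"
  have lc: "lp \<in> K" "lq \<in> K" "ls \<in> K" "lp \<noteq> 0" "lq \<noteq> 0" "ls \<noteq> 0"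
    using pq s \<open>p \<noteq> 0\<close> \<open>s \<noteq> 0\<close> by (auto simp: lp_def lq_def ls_def)
  define m where "m = int (degree p) - int (degree q)"
  \<comment> \<open>\<open>s\<close> is the numerator of \<open>1 - g\<close>. Comparing the degrees
    of \<open>p\<close> and \<open>q\<close> gives its leading coefficient as \<open>- lp\<close>,
    \<open>lq\<close> or \<open>lq - lp\<close>, unless the last of these cancels.\<close>
  define \<sigma> where "\<sigma> = dlog D ls - dlog D lq + (of_nat (degree s) - of_nat (degree q)) * e"
  have l: "lp / lq \<in> K - {0}" and dl: "dlog D (lp / lq) = dlog D lp - dlog D lq"
    using lc by (auto simp: K.dlog_divide)
  have dg: "dlog D g = dlog D (poly p \<theta>) - dlog D (poly q \<theta>)"
    unfolding pq(4) using pq \<open>p \<noteq> 0\<close> by (intro L.dlog_divide) auto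
  have dg1: "dlog D (1 - g) = dlog D (poly s \<theta>) - dlog D (poly q \<theta>)"
    unfolding g1 using pq s \<open>s \<noteq> 0\<close> by (intro L.dlog_divide) auto
  have lead: "dlog D (lp / lq) + of_int m * e =
      dlog D lp + of_nat (degree p) * e - (dlog D lq + of_nat (degree q) * e)"
    unfolding dl by (simp add: m_def algebra_simps)
  have c1: "dlog D g \<approx> dlog D (lp / lq) + of_int m * e"
    unfolding dg lead unfolding lp_def lq_def using pq \<open>p \<noteq> 0\<close> by (intro congM_diff dlog_poly)
  have "dlog D (1 - g) \<approx> dlog D ls + of_nat (degree s) * e - (dlog D lq + of_nat (degree q) * e)"
    unfolding dg1 ls_def lq_def using pq s \<open>s \<noteq> 0\<close> by (intro congM_diff dlog_poly)
  then have c3: "dlog D (1 - g) \<approx> \<sigma>"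
    by (simp add: \<sigma>_def algebra_simps)
  obtain \<alpha>p where \<alpha>p: "\<alpha>p \<in> K" "\<theta> * (dlog D (poly p \<theta>) - (dlog D lp + of_nat (degree p) * e))
      \<approx> of_nat (degree p) * b + D \<alpha>p - e * \<alpha>p"
    using dlog_poly_second_order[OF pq(1) \<open>p \<noteq> 0\<close>] unfolding lp_def by blast
  obtain \<alpha>q where \<alpha>q: "\<alpha>q \<in> K" "\<theta> * (dlog D (poly q \<theta>) - (dlog D lq + of_nat (degree q) * e))
      \<approx> of_nat (degree q) * b + D \<alpha>q - e * \<alpha>q"
    using dlog_poly_second_order[OF pq(2,3)] unfolding lq_def by blast
  have "\<theta> * (dlog D g - (dlog D (lp / lq) + of_int m * e)) =
      \<theta> * (dlog D (poly p \<theta>) - (dlog D lp + of_nat (degree p) * e))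
      - \<theta> * (dlog D (poly q \<theta>) - (dlog D lq + of_nat (degree q) * e))"
    unfolding dg lead by (simp add: algebra_simps)
  also have "\<dots> \<approx> of_nat (degree p) * b + D \<alpha>p - e * \<alpha>p - (of_nat (degree q) * b + D \<alpha>q - e * \<alpha>q)"
    using \<alpha>p(2) \<alpha>q(2) by (rule congM_diff)
  also have "\<dots> = of_int m * b + D (\<alpha>p - \<alpha>q) - e * (\<alpha>p - \<alpha>q)"
    using \<alpha>p(1) \<alpha>q(1) by (simp add: m_def K.D_diff algebra_simps)
  finally have c2: "\<theta> * (dlog D g - (dlog D (lp / lq) + of_int m * e))
      \<approx> of_int m * b + D (\<alpha>p - \<alpha>q) - e * (\<alpha>p - \<alpha>q)" .
  show ?thesis
  proof (rule that[of "lp / lq" "\<alpha>p - \<alpha>q" \<sigma> m])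
    show "\<sigma> = dlog D (lp / lq) + of_int m * e" if "m > 0"
    proof -
      have deg: "degree q < degree p" using that by (simp add: m_def)
      then have "degree s = degree p"
        unfolding s_def using degree_add_eq_right[of q "- p"] by simp
      then have "degree s = degree p" "ls = - lp"
        using deg by (auto simp: ls_def lp_def s_def coeff_eq_0)
      then show ?thesis
        using lc by (simp add: \<sigma>_def dl m_def K.dlog_uminus algebra_simps)
    qed
    show "\<sigma> = 0" if "m < 0"
    proof -
      have deg: "degree p < degree q" using that by (simp add: m_def)
      then have "degree s = degree q"
        unfolding s_def using degree_add_eq_left[of "- p" q] by simp
      then have "degree s = degree q" "ls = lq"
        using deg by (auto simp: ls_def lq_def s_def coeff_eq_0)
      then show ?thesis by (simp add: \<sigma>_def)
    qed
    show "\<sigma> = dlog D (1 - lp / lq)" if "m = 0" "lp / lq \<noteq> 1"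
    proof -
      have deg: "degree p = degree q" using that by (simp add: m_def)
      have nz: "coeff s (degree q) \<noteq> 0"
        using that lc deg by (auto simp: s_def lp_def lq_def)
      have "degree s \<le> degree q" unfolding s_def using deg by (intro degree_diff_le) auto
      then have "degree s = degree q" using nz le_degree by fastforce
      then have "degree s = degree q" "ls = lq - lp"
        using deg by (auto simp: ls_def lq_def lp_def s_def)
      moreover have "1 - lp / lq = ls / lq" using lc calculation by (simp add: field_simps)
      ultimately show ?thesis using lc by (simp add: \<sigma>_def K.dlog_divide)
    qed
    show "\<sigma> \<in> K" using lc by (auto simp: \<sigma>_def)
  qed (use l \<alpha>p \<alpha>q c1 c2 c3 in auto)
qed

section \<open>Integration modulo the maximal ideal\<close>

text \<open>\<open>z - k * \<theta>\<close> is a constant of \<open>L\<close>, hence lies in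
  \<open>K\<close>; a nonzero \<open>k\<close> would then put \<open>\<theta>\<close> into
  \<open>K\<close>.\<close>

lemma primitive_new:
  assumes "e = 0" "z \<in> K" "k \<in> K.C" "D z = k * b"
  shows "k = 0"
proof -
  have "D (z - k * \<theta>) = 0"
    using assms L.D_const_mult[of k \<theta>] constants_eq by (simp add: L.D_diff D_\<theta>)
  then have "z - k * \<theta> \<in> K" using assms by (intro K.const_mem const_L_mem) auto
  then have "k * \<theta> \<in> K" using K.diff_mem[of z "z - k * \<theta>"] assms by simp
  then show ?thesis using const_mult_\<theta>_mem assms by auto
qed

text \<open>Compare coefficients in the equation for the polynomial part \<open>s\<close> of
  \<open>x\<close>. If \<open>s\<close> had degree 3 or more, its leading coefficient would be
  constant and the next one would integrate a nonzero constant multiple of \<open>b\<close>, which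
  \<open>primitive_new\<close> forbids.\<close>

lemma primitive_integral:
  assumes e: "e = 0" and x: "x \<in> L" and \<alpha>\<beta>: "\<alpha> \<in> K" "\<beta> \<in> K" and Dx: "D x \<approx> \<alpha> + \<beta> * \<theta>"
  obtains \<kappa> w1 w0 where "\<kappa> \<in> K.C" "w1 \<in> K" "w0 \<in> K" "x \<approx> \<kappa> / 2 * \<theta>\<^sup>2 + w1 * \<theta> + w0"
    "\<beta> = D w1 + \<kappa> * b" "\<alpha> = D w0 + w1 * b"
proof -
  obtain s where s: "s \<in> P" "x \<approx> poly s \<theta>" using polynomial_part[OF x] .
  have "poly (poly_D s) \<theta> \<approx> poly [:\<alpha>, \<beta>:] \<theta>"
  proof -
    have "poly (poly_D s) \<theta> = D (poly s \<theta>)" using s by (simp add: D_poly_\<theta>)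
    also have "\<dots> \<approx> D x" using x s by (intro congM_sym[OF congM_D]) auto
    also note Dx
    finally show ?thesis by (simp add: mult.commute)
  qed
  then have Ds: "poly_D s = [:\<alpha>, \<beta>:]"
    using s \<alpha>\<beta> by (subst (asm) congM_poly_iff) auto
  have c: "coeff [:\<alpha>, \<beta>:] n = D (coeff s n) + of_nat (Suc n) * b * coeff s (Suc n)" for n
    using coeff_poly_D[of s n, unfolded Ds] e by (simp del: of_nat_Suc)
  have "degree s \<le> 2"
  proof (rule ccontr)
    assume "\<not> degree s \<le> 2"
    then obtain k where k: "degree s = Suc (Suc (Suc k))"
      by (metis Suc_le_D numeral_2_eq_2 not_less_eq_eq)
    define a where "a = lead_coeff s"
    have "s \<noteq> 0" using k by auto
    then have a: "a \<in> K" "a \<noteq> 0" using s by (simp_all add: a_def)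
    have "D a = 0" using c[of "degree s"] by (simp add: a_def k coeff_eq_0 del: of_nat_Suc)
    then have aC: "- (of_nat (degree s)) * a \<in> K.C"
      using a K.constI by (intro K.C.mult_mem K.C.uminus_mem K.C.of_nat_mem) auto
    have "0 = D (coeff s (Suc (Suc k))) + of_nat (degree s) * b * a"
      using c[of "Suc (Suc k)"] by (simp add: a_def k del: of_nat_Suc)
    then have "D (coeff s (Suc (Suc k))) = - (of_nat (degree s)) * a * b"
      by (simp add: algebra_simps eq_neg_iff_add_eq_0)
    then have "- (of_nat (degree s)) * a = 0" using primitive_new[OF e coeff_polys_over[OF s(1)] aC] by blast
    then show False using a k by (simp del: of_nat_Suc)
  qed
  then have s_eq: "s = [:coeff s 0, coeff s 1, coeff s 2:]"
    by (intro poly_eqI) (auto simp: coeff_pCons numeral_2_eq_2 coeff_eq_0 split: nat.splits)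
  have c3: "coeff s (Suc (Suc (Suc 0))) = 0" using \<open>degree s \<le> 2\<close> by (simp add: coeff_eq_0)
  show ?thesis
  \<comment> \<open>The coefficient equation in degree 1 contains \<open>2 * coeff s 2 * b\<close>,
    hence this choice of \<open>\<kappa>\<close>.\<close>
  proof (rule that[of "2 * coeff s 2" "coeff s 1" "coeff s 0"])
    have c2: "coeff s 2 = coeff s (Suc (Suc 0))" by (simp add: numeral_2_eq_2)
    have "D (coeff s 2) = 0" using c[of "Suc (Suc 0)"] c3 unfolding c2 by simp
    then have "coeff s 2 \<in> K.C" using s by (intro K.constI) auto
    then show "2 * coeff s 2 \<in> K.C" by (intro K.C.mult_mem K.C.numeral_mem)
    show "\<beta> = D (coeff s 1) + 2 * coeff s 2 * b" using c[of "Suc 0"] unfolding c2 by simp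
    show "\<alpha> = D (coeff s 0) + coeff s 1 * b" using c[of 0] by simp
    have "poly s \<theta> = coeff s 0 + \<theta> * (coeff s 1 + \<theta> * coeff s 2)" by (subst s_eq) simp
    then show "x \<approx> 2 * coeff s 2 / 2 * \<theta>\<^sup>2 + coeff s 1 * \<theta> + coeff s 0"
      using s(2) by (simp add: algebra_simps power2_eq_square)
  qed (use s in auto)
qed

text \<open>With no linear term on the right, \<open>D w1 = - \<kappa> * b\<close>; by
  \<open>primitive_new\<close>, \<open>\<kappa>\<close> vanishes and \<open>w1\<close> is a
  constant.\<close>

lemma primitive_integral_bounded:
  assumes e: "e = 0" and x: "x \<in> L" and \<alpha>: "\<alpha> \<in> K" and Dx: "D x \<approx> \<alpha>"
  obtains A B where "A \<in> K.C" "B \<in> K" "x \<approx> A * \<theta> + B" "D B = \<alpha> - A * b"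
proof -
  obtain \<kappa> w1 w0 where w: "\<kappa> \<in> K.C" "w1 \<in> K" "w0 \<in> K" "x \<approx> \<kappa> / 2 * \<theta>\<^sup>2 + w1 * \<theta> + w0"
    "0 = D w1 + \<kappa> * b" "\<alpha> = D w0 + w1 * b"
    using primitive_integral[OF e x \<alpha> K.zero_mem] Dx by auto
  have Dw1: "D w1 = - \<kappa> * b" using w(5) by (simp add: eq_neg_iff_add_eq_0)
  then have "\<kappa> = 0" using primitive_new[OF e w(2), of "- \<kappa>"] w by auto
  show ?thesis
  proof (rule that[of w1 w0])
    show "w1 \<in> K.C" using Dw1 w(2) \<open>\<kappa> = 0\<close> by (intro K.constI) auto
    show "x \<approx> w1 * \<theta> + w0" using w(4) \<open>\<kappa> = 0\<close> by simp
    show "D w0 = \<alpha> - w1 * b" using w(6) by simp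
  qed (rule w(3))
qed

text \<open>For an exponential, \<open>poly_D\<close> acts on each monomial separately. A monomial
  of positive degree in \<open>s\<close> would therefore be a constant of \<open>L\<close>, hence in
  \<open>K\<close>, against transcendence.\<close>

lemma exponential_integral:
  assumes b: "b = 0" and x: "x \<in> L" and k: "k \<in> K" and Dx: "D x \<approx> k"
  obtains B where "B \<in> K" "x \<approx> B" "D B = k"
proof -
  obtain s where s: "s \<in> P" "x \<approx> poly s \<theta>" using polynomial_part[OF x] .
  have "poly (poly_D s) \<theta> \<approx> poly [:k:] \<theta>"
  proof -
    have "poly (poly_D s) \<theta> = D (poly s \<theta>)" using s by (simp add: D_poly_\<theta>)
    also have "\<dots> \<approx> D x" using x s by (intro congM_sym[OF congM_D]) auto
    also note Dx
    finally show ?thesis by simp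
  qed
  then have Ds: "poly_D s = [:k:]" using s k by (subst (asm) congM_poly_iff) auto
  have "coeff s n = 0" if "n > 0" for n
  proof -
    define t where "t = monom (coeff s n) n"
    have t: "t \<in> P" using s by (simp add: t_def)
    have "coeff (poly_D t) i = 0" for i
      using coeff_poly_D[of s n, unfolded Ds] coeff_poly_D[of t i] that b
      by (cases "i = n") (auto simp: t_def coeff_pCons split: nat.splits)
    then have "D (poly t \<theta>) = 0" using t by (simp add: D_poly_\<theta> poly_eq_iff)
    then have z: "poly t \<theta> \<in> K" using t by (intro K.const_mem const_L_mem) auto
    have "t = [:poly t \<theta>:]" using z t poly_\<theta>_eq_iff[of t "[:poly t \<theta>:]"] by simp
    then have "degree t = 0" by (metis degree_pCons_0)
    then show ?thesis
      using that by (cases "coeff s n = 0") (auto simp: t_def degree_monom_eq)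
  qed
  then have "s = [:coeff s 0:]"
    by (intro poly_eqI) (auto simp: coeff_pCons split: nat.splits)
  then have "poly s \<theta> = coeff s 0" by (metis poly_0 poly_pCons mult_zero_right add_0_right)
  moreover have "D (coeff s 0) = k" using coeff_poly_D[of s 0, unfolded Ds] b by simp
  ultimately show ?thesis using s by (intro that[of "coeff s 0"]) auto
qed

section \<open>Passing from a representation over the extension to a reduced form\<close>

lemma leading_terms:
  assumes g: "\<And>i. i \<in> I \<Longrightarrow> g i \<in> L - {0, 1}"
  obtains l \<alpha> \<sigma> m where
    "\<forall>i\<in>I. l i \<in> K - {0} \<and> \<alpha> i \<in> K \<and> \<sigma> i \<in> K \<and>
      dlog D (g i) \<approx> dlog D (l i) + of_int (m i) * e \<and>
      \<theta> * (dlog D (g i) - (dlog D (l i) + of_int (m i) * e)) \<approx> of_int (m i) * b + D (\<alpha> i) - e * \<alpha> i \<and>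
      dlog D (1 - g i) \<approx> \<sigma> i \<and>
      (m i > 0 \<longrightarrow> \<sigma> i = dlog D (l i) + of_int (m i) * e) \<and> (m i < 0 \<longrightarrow> \<sigma> i = 0) \<and>
      (m i = 0 \<longrightarrow> l i \<noteq> 1 \<longrightarrow> \<sigma> i = dlog D (1 - l i))"
proof -
  have "\<forall>i\<in>I. \<exists>l \<alpha> \<sigma> m. l \<in> K - {0} \<and> \<alpha> \<in> K \<and> \<sigma> \<in> K \<and>
      dlog D (g i) \<approx> dlog D l + of_int m * e \<and>
      \<theta> * (dlog D (g i) - (dlog D l + of_int m * e)) \<approx> of_int m * b + D \<alpha> - e * \<alpha> \<and>
      dlog D (1 - g i) \<approx> \<sigma> \<and>
      (m > 0 \<longrightarrow> \<sigma> = dlog D l + of_int m * e) \<and> (m < 0 \<longrightarrow> \<sigma> = 0) \<and>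
      (m = 0 \<longrightarrow> l \<noteq> 1 \<longrightarrow> \<sigma> = dlog D (1 - l))"
  proof
    fix i assume "i \<in> I"
    then have gi: "g i \<in> L" "g i \<noteq> 0" "g i \<noteq> 1" using g by auto
    show "\<exists>l \<alpha> \<sigma> m. l \<in> K - {0} \<and> \<alpha> \<in> K \<and> \<sigma> \<in> K \<and>
      dlog D (g i) \<approx> dlog D l + of_int m * e \<and>
      \<theta> * (dlog D (g i) - (dlog D l + of_int m * e)) \<approx> of_int m * b + D \<alpha> - e * \<alpha> \<and>
      dlog D (1 - g i) \<approx> \<sigma> \<and>
      (m > 0 \<longrightarrow> \<sigma> = dlog D l + of_int m * e) \<and> (m < 0 \<longrightarrow> \<sigma> = 0) \<and>
      (m = 0 \<longrightarrow> l \<noteq> 1 \<longrightarrow> \<sigma> = dlog D (1 - l))"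
      by (rule leading_term[OF gi]) blast
  qed
  then show ?thesis unfolding bchoice_iff using that by blast
qed

text \<open>The arguments \<open>g i\<close> survive only through the expansions of
  \<open>q i\<close>, their logarithmic derivatives. If \<open>m i > 0\<close>, then
  \<open>1 - g i\<close> and \<open>g i\<close> have logarithmic derivatives with the same residue,
  so \<open>c i\<close> moves to the diagonal of the matrix, which stays symmetric; if
  \<open>m i < 0\<close>, the residue for \<open>1 - g i\<close> is 0 and \<open>c i\<close> is
  dropped. Hence the new \<open>c i\<close> vanishes unless \<open>m i = 0\<close>.\<close>

lemma leading_part_of_integral:
  assumes int: "dilog_integrable D L f"
  obtains I :: "nat set" and w r q l \<alpha> \<sigma> c cc m where
    "finite I" "w \<in> L" "f = (\<Sum>i\<in>I. r i * q i) + D w"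
    "\<And>i. i \<in> I \<Longrightarrow> r i \<in> L" "\<And>i. i \<in> I \<Longrightarrow> l i \<in> K - {0}"
    "\<And>i. i \<in> I \<Longrightarrow> \<alpha> i \<in> K" "\<And>i. i \<in> I \<Longrightarrow> \<sigma> i \<in> K" "\<And>i. i \<in> I \<Longrightarrow> c i \<in> K.C"
    "\<And>i j. i \<in> I \<Longrightarrow> j \<in> I \<Longrightarrow> cc i j \<in> K.C \<and> cc i j = cc j i"
    "\<And>i. i \<in> I \<Longrightarrow> q i \<approx> dlog D (l i) + of_int (m i) * e"
    "\<And>i. i \<in> I \<Longrightarrow> \<theta> * (q i - (dlog D (l i) + of_int (m i) * e))
      \<approx> of_int (m i) * b + D (\<alpha> i) - e * \<alpha> i"
    "\<And>i. i \<in> I \<Longrightarrow> D (r i) \<approx> c i * \<sigma> i + (\<Sum>j\<in>I. cc i j * (dlog D (l j) + of_int (m j) * e))"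
    "\<And>i. i \<in> I \<Longrightarrow> of_int (m i) * c i = 0"
    "\<And>i. i \<in> I \<Longrightarrow> l i \<noteq> 1 \<Longrightarrow> c i * \<sigma> i = c i * dlog D (1 - l i)"
proof (rule L.dilog_integrableE[OF int, unfolded constants_eq])
  fix I :: "nat set" and r g w c cc
  assume I: "finite I" and r: "\<And>i. i \<in> I \<Longrightarrow> r i \<in> L" and g: "\<And>i. i \<in> I \<Longrightarrow> g i \<in> L - {0, 1}"
    and w: "w \<in> L" and c: "\<And>i. i \<in> I \<Longrightarrow> c i \<in> K.C"
    and cc: "\<And>i j. i \<in> I \<Longrightarrow> j \<in> I \<Longrightarrow> cc i j \<in> K.C \<and> cc i j = cc j i"
    and f: "f = (\<Sum>i\<in>I. r i * dlog D (g i)) + D w"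
    and Dr: "\<And>i. i \<in> I \<Longrightarrow> D (r i) = c i * dlog D (1 - g i) + (\<Sum>j\<in>I. cc i j * dlog D (g j))"
  obtain l \<alpha> \<sigma> m where "\<forall>i\<in>I. l i \<in> K - {0} \<and> \<alpha> i \<in> K \<and> \<sigma> i \<in> K \<and>
      dlog D (g i) \<approx> dlog D (l i) + of_int (m i) * e \<and>
      \<theta> * (dlog D (g i) - (dlog D (l i) + of_int (m i) * e)) \<approx> of_int (m i) * b + D (\<alpha> i) - e * \<alpha> i \<and>
      dlog D (1 - g i) \<approx> \<sigma> i \<and>
      (m i > 0 \<longrightarrow> \<sigma> i = dlog D (l i) + of_int (m i) * e) \<and> (m i < 0 \<longrightarrow> \<sigma> i = 0) \<and>
      (m i = 0 \<longrightarrow> l i \<noteq> 1 \<longrightarrow> \<sigma> i = dlog D (1 - l i))"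
    using leading_terms[OF g] .
  note lead = bspec[OF this]
  define c' where "c' i = (if m i = 0 then c i else 0)" for i
  define cc' where "cc' i j = cc i j + (if i = j \<and> m i > 0 then c i else 0)" for i j
  define \<Lambda> where "\<Lambda> i = dlog D (l i) + of_int (m i) * e" for i
  show ?thesis
  proof (rule that[of I w r "\<lambda>i. dlog D (g i)" l \<alpha> \<sigma> c' cc' m, OF I w f])
    fix i assume i: "i \<in> I"
    have "D (r i) \<approx> c i * \<sigma> i + (\<Sum>j\<in>I. cc i j * \<Lambda> j)"
      unfolding Dr[OF i] \<Lambda>_def
      using c cc lead i by (intro congM_add congM_sum congM_K_mult) (auto intro: K.const_mem)
    also have "c i * \<sigma> i + (\<Sum>j\<in>I. cc i j * \<Lambda> j) = c' i * \<sigma> i + (\<Sum>j\<in>I. cc' i j * \<Lambda> j)"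
    proof -
      have "(\<Sum>j\<in>I. cc' i j * \<Lambda> j) = (\<Sum>j\<in>I. cc i j * \<Lambda> j + (if j = i then (if m i > 0 then c i else 0) * \<Lambda> i else 0))"
        by (intro sum.cong) (auto simp: cc'_def algebra_simps)
      also have "\<dots> = (\<Sum>j\<in>I. cc i j * \<Lambda> j) + (if m i > 0 then c i else 0) * \<Lambda> i"
        using I i by (simp add: sum.distrib)
      finally show ?thesis
        using lead[OF i] by (cases "m i" "0::int" rule: linorder_cases) (auto simp: c'_def \<Lambda>_def)
    qed
    finally show "D (r i) \<approx> c' i * \<sigma> i + (\<Sum>j\<in>I. cc' i j * (dlog D (l j) + of_int (m j) * e))"
      unfolding \<Lambda>_def .
    show "c' i * \<sigma> i = c' i * dlog D (1 - l i)" if "l i \<noteq> 1"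
      using lead[OF i] that by (simp add: c'_def)
    show "cc' i j \<in> K.C \<and> cc' i j = cc' j i" if "j \<in> I" for j
      using cc[OF i that] c[OF i] by (auto simp: cc'_def)
    show "c' i \<in> K.C" "of_int (m i) * c' i = 0" using c[OF i] by (auto simp: c'_def)
  qed (use lead r in blast)+
qed

text \<open>Each \<open>r i\<close> is affine in \<open>\<theta>\<close> modulo \<open>M\<close>, so
  every product \<open>r i * q i\<close> is too, and \<open>D w\<close> is congruent to an affine
  function of \<open>\<theta>\<close>. Integrating it and comparing coefficients gives the equations
  for \<open>f\<close> and \<open>R\<close>.\<close>

lemma primitive_reduced_form:
  assumes e: "e = 0" and f: "f \<in> K" and int: "dilog_integrable D L f"
  obtains I :: "nat set" and A B l c cc \<kappa> R w where "K.reduced_form b f I A B l c cc \<kappa> R w"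
proof (rule leading_part_of_integral[OF int])
  fix I :: "nat set" and w r q l \<alpha> \<sigma> c cc m
  assume I: "finite I" and w: "w \<in> L"
    and f_eq: "f = (\<Sum>i\<in>I. r i * q i) + D w"
    and r: "\<And>i. i \<in> I \<Longrightarrow> r i \<in> L"
    and l: "\<And>i. i \<in> I \<Longrightarrow> l i \<in> K - {0}"
    and \<alpha>: "\<And>i. i \<in> I \<Longrightarrow> \<alpha> i \<in> K" and \<sigma>: "\<And>i. i \<in> I \<Longrightarrow> \<sigma> i \<in> K"
    and c: "\<And>i. i \<in> I \<Longrightarrow> c i \<in> K.C"
    and cc: "\<And>i j. i \<in> I \<Longrightarrow> j \<in> I \<Longrightarrow> cc i j \<in> K.C \<and> cc i j = cc j i"
    and q_lead: "\<And>i. i \<in> I \<Longrightarrow> q i \<approx> dlog D (l i) + of_int (m i) * e"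
    and q_second: "\<And>i. i \<in> I \<Longrightarrow> \<theta> * (q i - (dlog D (l i) + of_int (m i) * e))
      \<approx> of_int (m i) * b + D (\<alpha> i) - e * \<alpha> i"
    and Dr: "\<And>i. i \<in> I \<Longrightarrow> D (r i) \<approx> c i * \<sigma> i + (\<Sum>j\<in>I. cc i j * (dlog D (l j) + of_int (m j) * e))"
    and mc: "\<And>i. i \<in> I \<Longrightarrow> of_int (m i) * c i = 0"
    and \<sigma>_eq: "\<And>i. i \<in> I \<Longrightarrow> l i \<noteq> 1 \<Longrightarrow> c i * \<sigma> i = c i * dlog D (1 - l i)"
  define \<tau> where "\<tau> i = of_int (m i) * b + D (\<alpha> i)" for i
  define k where "k i = c i * \<sigma> i + (\<Sum>j\<in>I. cc i j * dlog D (l j))" for i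
  have q1: "q i \<approx> dlog D (l i)" and q2: "\<theta> * (q i - dlog D (l i)) \<approx> \<tau> i" if "i \<in> I" for i
    using q_lead[OF that] q_second[OF that] by (simp_all add: e \<tau>_def)
  have "\<exists>A B. A \<in> K.C \<and> B \<in> K \<and> r i \<approx> A * \<theta> + B \<and> D B = k i - A * b" if i: "i \<in> I" for i
  proof -
    have "D (r i) \<approx> k i" using Dr[OF i] by (simp add: e k_def)
    moreover have "k i \<in> K" unfolding k_def
      using c cc \<sigma> l i by (intro K.add_mem K.mult_mem K.sum_mem) (auto intro: K.const_mem)
    ultimately show ?thesis using primitive_integral_bounded[OF e r[OF i]] by metis
  qed
  then obtain A B where AB: "A i \<in> K.C" "B i \<in> K" "r i \<approx> A i * \<theta> + B i" "D (B i) = k i - A i * b"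
    if "i \<in> I" for i by metis
  define \<Lambda> where "\<Lambda> i = dlog D (l i)" for i
  have \<Lambda>: "\<Lambda> i \<in> K" and \<tau>: "\<tau> i \<in> K" if "i \<in> I" for i
    using l[OF that] \<alpha>[OF that] by (auto simp: \<Lambda>_def \<tau>_def)
  have AK: "A i \<in> K" if "i \<in> I" for i using AB(1)[OF that] by simp
  have rq: "r i * q i \<approx> A i * \<Lambda> i * \<theta> + (B i * \<Lambda> i + A i * \<tau> i)" if i: "i \<in> I" for i
  proof -
    define \<mu> where "\<mu> = r i - (A i * \<theta> + B i)"
    define \<nu> where "\<nu> = q i - \<Lambda> i"
    have "\<mu> \<in> M" "\<nu> \<in> M" "\<theta> * \<nu> - \<tau> i \<in> M"
      using AB(3)[OF i] q1[OF i] q2[OF i] by (auto simp: \<mu>_def \<nu>_def \<Lambda>_def congM_def)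
    \<comment> \<open>The part \<open>A i * \<theta>\<close> of \<open>r i\<close> meets the
      \<open>1 / \<theta>\<close> term of \<open>q i\<close>; their product contributes
      \<open>A i * \<tau> i\<close> in degree 0.\<close>
    then have "\<mu> * \<nu> + \<Lambda> i * \<mu> + A i * (\<theta> * \<nu> - \<tau> i) + B i * \<nu> \<in> M"
      using \<Lambda>[OF i] AK[OF i] AB(2)[OF i] by (intro add_M mult_M K_mult_M)
    then show ?thesis unfolding congM_def \<mu>_def \<nu>_def by (simp add: algebra_simps)
  qed
  define \<alpha>' where "\<alpha>' = f - (\<Sum>i\<in>I. B i * \<Lambda> i + A i * \<tau> i)"
  define \<beta>' where "\<beta>' = - (\<Sum>i\<in>I. A i * \<Lambda> i)"
  have \<alpha>'\<beta>': "\<alpha>' \<in> K" "\<beta>' \<in> K"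
    using f AB(2) AK \<Lambda> \<tau> by (auto simp: \<alpha>'_def \<beta>'_def intro!: K.diff_mem K.uminus_mem K.sum_mem)
  have "D w = f - (\<Sum>i\<in>I. r i * q i)" using f_eq by simp
  also have "\<dots> \<approx> f - (\<Sum>i\<in>I. A i * \<Lambda> i * \<theta> + (B i * \<Lambda> i + A i * \<tau> i))"
    using rq by (intro congM_diff congM_sum congM_refl)
  also have "\<dots> = \<alpha>' + \<beta>' * \<theta>"
    by (simp add: \<alpha>'_def \<beta>'_def sum.distrib sum_distrib_right)
  finally have Dw: "D w \<approx> \<alpha>' + \<beta>' * \<theta>" .
  obtain \<kappa> w1 w0 where w01: "\<kappa> \<in> K.C" "w1 \<in> K" "w0 \<in> K" "\<beta>' = D w1 + \<kappa> * b" "\<alpha>' = D w0 + w1 * b"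
    using primitive_integral[OF e w \<alpha>'\<beta>' Dw] by metis
  \<comment> \<open>As the \<open>A i\<close> are constants, the second-order terms add up to
    \<open>s * b + D t\<close>: \<open>s\<close> goes into \<open>R\<close>, without changing its
    derivative, and \<open>t\<close> goes into the exact part.\<close>
  define s where "s = (\<Sum>i\<in>I. A i * of_int (m i))"
  define t where "t = (\<Sum>i\<in>I. A i * \<alpha> i)"
  have s: "s \<in> K.C" unfolding s_def using AB(1) by (intro K.C.sum_mem K.C.mult_mem K.C.of_int_mem)
  have t: "t \<in> K" "D t = (\<Sum>i\<in>I. A i * D (\<alpha> i))"
    unfolding t_def using AK AB(1) \<alpha> by (auto simp: K.D_sum K.D_const_mult)
  have sum_\<tau>: "(\<Sum>i\<in>I. A i * \<tau> i) = s * b + D t"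
    unfolding t(2) by (simp add: \<tau>_def s_def sum.distrib sum_distrib_left sum_distrib_right algebra_simps)
  show ?thesis
  proof (rule that)
    show "K.reduced_form b f I A B l c cc \<kappa> (w1 + s) (w0 + t)"
      unfolding K.reduced_form_def
    proof (intro conjI ballI impI)
      have "f = \<alpha>' + (\<Sum>i\<in>I. B i * \<Lambda> i) + (\<Sum>i\<in>I. A i * \<tau> i)"
        by (simp add: \<alpha>'_def sum.distrib)
      also have "\<dots> = (\<Sum>i\<in>I. B i * \<Lambda> i) + D (w0 + t) + b * (w1 + s)"
        unfolding sum_\<tau> w01(5) using w01(3) t(1) by (simp add: K.D_add algebra_simps)
      finally show "f = (\<Sum>i\<in>I. B i * dlog D (l i)) + D (w0 + t) + b * (w1 + s)"
        by (simp add: \<Lambda>_def)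
      have "D (w1 + s) = D w1" using w01(2) s by (simp add: K.D_add)
      then show "D (w1 + s) = - (\<Sum>i\<in>I. A i * dlog D (l i)) - \<kappa> * b"
        using w01(4) by (simp add: \<beta>'_def \<Lambda>_def eq_diff_eq)
      show "D (B i) = c i * dlog D (1 - l i) + (\<Sum>j\<in>I. cc i j * dlog D (l j)) - A i * b"
        if "i \<in> I" "l i \<noteq> 1" for i
        using AB(4)[OF that(1)] \<sigma>_eq[OF that] by (simp add: k_def)
      show "w1 + s \<in> K" "w0 + t \<in> K" using w01 s t by auto
    qed (use I w01(1) AB l c cc in auto)
  qed
qed

text \<open>Here each \<open>r i\<close> is congruent to an element \<open>B i\<close> of
  \<open>K\<close>, so leading residues suffice. The multiples of \<open>e\<close> in them are
  collected in \<open>R\<close>, the sum of the \<open>n i * B i\<close>, and in the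
  \<open>A i\<close>.\<close>

lemma exponential_reduced_form:
  assumes b: "b = 0" and f: "f \<in> K" and int: "dilog_integrable D L f"
  obtains I :: "nat set" and A B l c cc \<kappa> R w where "K.reduced_form e f I A B l c cc \<kappa> R w"
proof (rule leading_part_of_integral[OF int])
  fix I :: "nat set" and w r q l \<alpha> \<sigma> c cc m
  assume I: "finite I" and w: "w \<in> L"
    and f_eq: "f = (\<Sum>i\<in>I. r i * q i) + D w"
    and r: "\<And>i. i \<in> I \<Longrightarrow> r i \<in> L"
    and l: "\<And>i. i \<in> I \<Longrightarrow> l i \<in> K - {0}"
    and \<alpha>: "\<And>i. i \<in> I \<Longrightarrow> \<alpha> i \<in> K" and \<sigma>: "\<And>i. i \<in> I \<Longrightarrow> \<sigma> i \<in> K"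
    and c: "\<And>i. i \<in> I \<Longrightarrow> c i \<in> K.C"
    and cc: "\<And>i j. i \<in> I \<Longrightarrow> j \<in> I \<Longrightarrow> cc i j \<in> K.C \<and> cc i j = cc j i"
    and q_lead: "\<And>i. i \<in> I \<Longrightarrow> q i \<approx> dlog D (l i) + of_int (m i) * e"
    and q_second: "\<And>i. i \<in> I \<Longrightarrow> \<theta> * (q i - (dlog D (l i) + of_int (m i) * e))
      \<approx> of_int (m i) * b + D (\<alpha> i) - e * \<alpha> i"
    and Dr: "\<And>i. i \<in> I \<Longrightarrow> D (r i) \<approx> c i * \<sigma> i + (\<Sum>j\<in>I. cc i j * (dlog D (l j) + of_int (m j) * e))"
    and mc: "\<And>i. i \<in> I \<Longrightarrow> of_int (m i) * c i = 0"
    and \<sigma>_eq: "\<And>i. i \<in> I \<Longrightarrow> l i \<noteq> 1 \<Longrightarrow> c i * \<sigma> i = c i * dlog D (1 - l i)"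
  define n where "n i = (of_int (m i) :: 'a)" for i
  define \<Lambda> where "\<Lambda> i = dlog D (l i)" for i
  define k where "k i = c i * \<sigma> i + (\<Sum>j\<in>I. cc i j * (\<Lambda> j + n j * e))" for i
  have n: "n i \<in> K.C" "n i \<in> K" for i by (auto simp: n_def)
  have \<Lambda>: "\<Lambda> i \<in> K" if "i \<in> I" for i using l[OF that] by (auto simp: \<Lambda>_def)
  have "\<exists>B. B \<in> K \<and> r i \<approx> B \<and> D B = k i" if i: "i \<in> I" for i
  proof -
    have "D (r i) \<approx> k i" using Dr[OF i] by (simp add: k_def \<Lambda>_def n_def)
    moreover have "k i \<in> K" unfolding k_def
      using c cc \<sigma> \<Lambda> n i by (intro K.add_mem K.mult_mem K.sum_mem) (auto intro: K.const_mem)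
    ultimately show ?thesis using exponential_integral[OF b r[OF i]] by metis
  qed
  then obtain B where B: "B i \<in> K" "r i \<approx> B i" "D (B i) = k i" if "i \<in> I" for i by metis
  have rq: "r i * q i \<approx> B i * (\<Lambda> i + n i * e)" if i: "i \<in> I" for i
  proof -
    define \<mu> where "\<mu> = r i - B i"
    define \<nu> where "\<nu> = q i - (\<Lambda> i + n i * e)"
    have "\<mu> \<in> M" "\<nu> \<in> M"
      using B(2)[OF i] q_lead[OF i] by (auto simp: \<mu>_def \<nu>_def \<Lambda>_def n_def congM_def)
    then have "\<mu> * \<nu> + (\<Lambda> i + n i * e) * \<mu> + B i * \<nu> \<in> M"
      using \<Lambda>[OF i] n B(1)[OF i] by (intro add_M mult_M K_mult_M) auto
    then show ?thesis unfolding congM_def \<mu>_def \<nu>_def by (simp add: algebra_simps)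
  qed
  define k' where "k' = f - (\<Sum>i\<in>I. B i * (\<Lambda> i + n i * e))"
  have k': "k' \<in> K"
    unfolding k'_def using f B(1) \<Lambda> n by (intro K.diff_mem K.sum_mem) auto
  have "D w = f - (\<Sum>i\<in>I. r i * q i)" using f_eq by simp
  also have "\<dots> \<approx> k'"
    unfolding k'_def using rq by (intro congM_diff congM_sum congM_refl)
  finally obtain w0 where w0: "w0 \<in> K" "D w0 = k'"
    using exponential_integral[OF b w k'] by metis
  define A where "A i = - (\<Sum>j\<in>I. cc i j * n j)" for i
  define R where "R = (\<Sum>i\<in>I. n i * B i)"
  define \<kappa> where "\<kappa> = - (\<Sum>i\<in>I. \<Sum>j\<in>I. n i * cc i j * n j)"
  have "D R = (\<Sum>i\<in>I. n i * k i)"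
    unfolding R_def using B n by (simp add: K.D_sum K.D_const_mult)
  also have "\<dots> = (\<Sum>i\<in>I. \<Sum>j\<in>I. n i * cc i j * \<Lambda> j) + (\<Sum>i\<in>I. \<Sum>j\<in>I. n i * cc i j * n j) * e"
  proof -
    have "n i * k i = (\<Sum>j\<in>I. n i * cc i j * \<Lambda> j) + (\<Sum>j\<in>I. n i * cc i j * n j) * e"
      if "i \<in> I" for i
    proof -
      have "n i * k i = (n i * c i) * \<sigma> i + n i * (\<Sum>j\<in>I. cc i j * (\<Lambda> j + n j * e))"
        by (simp add: k_def algebra_simps)
      \<comment> \<open>This removes the unknown residues \<open>\<sigma> i\<close> from
        \<open>D R\<close>.\<close>
      also have "n i * c i = 0" using mc[OF that] by (simp add: n_def)
      finally show ?thesis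
        by (simp add: sum_distrib_left sum_distrib_right sum.distrib algebra_simps)
    qed
    then show ?thesis by (simp add: sum.distrib sum_distrib_right)
  qed
  \<comment> \<open>Symmetry of \<open>cc\<close> identifies the column sums occurring in
    \<open>D R\<close> with the row sums that define \<open>A\<close>.\<close>
  also have "(\<Sum>i\<in>I. \<Sum>j\<in>I. n i * cc i j * \<Lambda> j) = (\<Sum>j\<in>I. \<Sum>i\<in>I. n i * cc i j * \<Lambda> j)"
    by (rule sum.swap)
  also have "\<dots> = - (\<Sum>j\<in>I. A j * \<Lambda> j)"
    unfolding A_def sum_negf[symmetric] minus_mult_left[symmetric] minus_minus sum_distrib_right
    using cc by (intro sum.cong refl) (metis mult.commute)
  finally have DR: "D R = - (\<Sum>j\<in>I. A j * \<Lambda> j) - \<kappa> * e" by (simp add: \<kappa>_def)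
  show ?thesis
  proof (rule that)
    show "K.reduced_form e f I A B l c cc \<kappa> R w0"
      unfolding K.reduced_form_def
    proof (intro conjI ballI impI)
      show "D R = - (\<Sum>i\<in>I. A i * dlog D (l i)) - \<kappa> * e" using DR by (simp add: \<Lambda>_def)
      have "f = k' + (\<Sum>i\<in>I. B i * \<Lambda> i) + e * R"
        by (simp add: k'_def R_def sum.distrib sum_distrib_left algebra_simps)
      then show "f = (\<Sum>i\<in>I. B i * dlog D (l i)) + D w0 + e * R" by (simp add: w0 \<Lambda>_def)
      show "D (B i) = c i * dlog D (1 - l i) + (\<Sum>j\<in>I. cc i j * dlog D (l j)) - A i * e"
        if "i \<in> I" "l i \<noteq> 1" for i
        unfolding B(3)[OF that(1)] k_def \<sigma>_eq[OF that]
        by (simp add: A_def \<Lambda>_def sum.distrib sum_distrib_left algebra_simps)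
      show "A i \<in> K.C" if "i \<in> I" for i
        unfolding A_def using cc that n by (intro K.C.uminus_mem K.C.sum_mem K.C.mult_mem) auto
      show "\<kappa> \<in> K.C"
        unfolding \<kappa>_def using cc n by (intro K.C.uminus_mem K.C.sum_mem K.C.mult_mem) auto
      show "R \<in> K" unfolding R_def using B n by auto
    qed (use I w0 B l c cc in auto)
  qed
qed

section \<open>Descent through a single generator\<close>

text \<open>\<open>b\<close> is a single logarithmic derivative over \<open>K\<close>, with no exact
  part.\<close>

lemma logarithm_descent:
  assumes "e = 0" "\<eta> \<in> K - {0}" "b = dlog D \<eta>" "f \<in> K" "dilog_integrable D L f"
  shows "dilog_integrable D K f"
proof -
  obtain I :: "nat set" and A B l c cc \<kappa> R w where "K.reduced_form b f I A B l c cc \<kappa> R w"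
    using primitive_reduced_form[OF assms(1,4,5)] .
  then show ?thesis
    by (rule K.reduced_form_elementary[where J = "{0::nat}" and \<gamma> = "\<lambda>_. 1" and \<eta> = "\<lambda>_. \<eta>" and z = 0])
      (use assms in auto)
qed

text \<open>In the reduced form \<open>e\<close> takes the place of \<open>b\<close>; it is the
  derivative of \<open>a\<close>, so no new logarithm is needed.\<close>

lemma exponential_descent:
  assumes "b = 0" "a \<in> K" "e = D a" "f \<in> K" "dilog_integrable D L f"
  shows "dilog_integrable D K f"
proof -
  obtain I :: "nat set" and A B l c cc \<kappa> R w where "K.reduced_form e f I A B l c cc \<kappa> R w"
    using exponential_reduced_form[OF assms(1,4,5)] .
  then show ?thesis
    by (rule K.reduced_form_elementary[where J = "{} :: nat set" and z = a]) (use assms in auto)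
qed

lemma dilogarithm_descent:
  assumes "e = 0" "g \<in> K - {0, 1}" "\<phi> \<in> K" "D \<phi> = - dlog D (1 - g)" "b = dlog D g * \<phi>"
    and "f \<in> K" "dilog_integrable D L f"
  shows "dilog_integrable D K f"
proof -
  obtain I :: "nat set" and A B l c cc \<kappa> R w where "K.reduced_form b f I A B l c cc \<kappa> R w"
    using primitive_reduced_form[OF assms(1,6,7)] .
  then show ?thesis
    using assms(2-5) by (rule K.reduced_form_dilog) (rule primitive_new[OF assms(1)])
qed

end

section \<open>The auxiliary logarithm of a dilogarithm\<close>

context simple_transcendental_extension
begin

text \<open>
  Let \<open>q\<close> be a denominator of \<open>\<phi>\<close> of minimal degree. The equation for \<open>D \<phi>\<close> shows that
  \<open>pderiv q\<close> is a denominator of \<open>\<phi>\<close>, too, so \<open>q\<close> is constant; then compare degrees.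
\<close>

lemma affine_of_derivative:
  assumes h: "h \<in> K" and D\<theta>: "D \<theta> = h * \<phi>" and \<phi>: "\<phi> \<in> L" and D\<phi>: "D \<phi> \<in> K"
  shows "\<exists>c\<in>K. \<exists>d\<in>K. \<phi> = c * \<theta> + d"
proof -
  \<comment> \<open>Otherwise \<open>\<theta>\<close> would be a constant of \<open>L\<close> and so
    lie in \<open>K\<close>.\<close>
  have "h \<noteq> 0" using D\<theta> const_L_mem[OF \<theta>_mem] \<theta>_not_mem by auto
  define denom where "denom q \<longleftrightarrow> q \<in> P \<and> q \<noteq> 0 \<and> (\<exists>p\<in>P. poly q \<theta> * \<phi> = poly p \<theta>)" for q
  obtain p0 q0 where pq0: "p0 \<in> P" "q0 \<in> P" "q0 \<noteq> 0" "\<phi> = poly p0 \<theta> / poly q0 \<theta>"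
    using fraction[OF \<phi>] by blast
  then have "denom q0" unfolding denom_def by (auto intro!: bexI[of _ p0])
  then obtain q where q_denom: "denom q" and q_min: "\<And>v. denom v \<Longrightarrow> degree q \<le> degree v"
    using ex_has_least_nat[of denom q0 degree] by blast
  then obtain p where q: "q \<in> P" "q \<noteq> 0" and p: "p \<in> P" "poly q \<theta> * \<phi> = poly p \<theta>"
    unfolding denom_def by blast
  define k where "k = D \<phi>"
  have k: "k \<in> K" using D\<phi> by (simp add: k_def)
  define Dp Dq where "Dp = map_poly D p" and "Dq = map_poly D q"
  have Dpq: "Dp \<in> P" "Dq \<in> P" using p q by (auto simp: Dp_def Dq_def)
  \<comment> \<open>Differentiate \<open>q * \<phi> = p\<close> and multiply by \<open>q\<close>:
    the term quadratic in \<open>\<phi>\<close> becomes \<open>h * v * \<phi>\<close>, and all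
    others together are \<open>h * t\<close>.\<close>
  define v where "v = pderiv q * p"
  define t where "t = smult (1 / h) (Dp * q + smult h (pderiv p * p) - Dq * p - smult k (q * q))"
  have v: "v \<in> P" and t: "t \<in> P" using p q h k Dpq by (auto simp: v_def t_def)
  have "(poly Dq \<theta> + poly (pderiv q) \<theta> * (h * \<phi>)) * \<phi> + poly q \<theta> * k
      = poly Dp \<theta> + poly (pderiv p) \<theta> * (h * \<phi>)"
  proof -
    have "D (poly q \<theta> * \<phi>) = (poly Dq \<theta> + poly (pderiv q) \<theta> * (h * \<phi>)) * \<phi> + poly q \<theta> * k"
      using q \<phi> by (simp add: L.D_mult D_poly D\<theta> k_def Dq_def)
    moreover have "D (poly p \<theta>) = poly Dp \<theta> + poly (pderiv p) \<theta> * (h * \<phi>)"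
      using p(1) by (simp add: D_poly D\<theta> Dp_def)
    ultimately show ?thesis using p(2) by simp
  qed
  then have "((poly Dq \<theta> + poly (pderiv q) \<theta> * (h * \<phi>)) * \<phi> + poly q \<theta> * k) * poly q \<theta>
      = (poly Dp \<theta> + poly (pderiv p) \<theta> * (h * \<phi>)) * poly q \<theta>" by simp
  then have "h * (poly v \<theta> * \<phi>) = h * poly t \<theta>"
    using \<open>h \<noteq> 0\<close> by (simp add: v_def t_def p(2)[symmetric] algebra_simps)
  then have vt: "poly v \<theta> * \<phi> = poly t \<theta>" using \<open>h \<noteq> 0\<close> by simp
  \<comment> \<open>A nonzero remainder would be a denominator of smaller degree, so
    \<open>q\<close> divides \<open>pderiv q * p\<close>; cancelling \<open>q\<close> after writing
    \<open>p\<close> as \<open>q * \<phi>\<close> shows that \<open>pderiv q * \<phi>\<close> is a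
    polynomial in \<open>\<theta>\<close>.\<close>
  obtain s r where sr: "s \<in> P" "r \<in> P" "v = q * s + r" "r = 0 \<or> degree r < degree q"
    using K.polys_over_division[OF v q] by blast
  have "poly r \<theta> * \<phi> = poly (t - s * p) \<theta>"
    using vt by (simp add: sr(3) p(2)[symmetric] algebra_simps)
  moreover have "t - s * p \<in> P" using t sr p by simp
  ultimately have "r = 0"
    using q_min[of r] sr unfolding denom_def by fastforce
  then have "poly (pderiv q) \<theta> * poly p \<theta> = poly q \<theta> * poly s \<theta>"
    using sr(3) by (metis add_0_right poly_mult v_def)
  then have "poly q \<theta> * (poly (pderiv q) \<theta> * \<phi>) = poly q \<theta> * poly s \<theta>"
    by (simp add: p(2)[symmetric] mult_ac)
  then have "poly (pderiv q) \<theta> * \<phi> = poly s \<theta>" using q by simp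
  then have "pderiv q = 0 \<or> degree q \<le> degree (pderiv q)"
    using q_min[of "pderiv q"] q sr unfolding denom_def by auto
  then have "degree q = 0" using pderiv_eq_0_iff[of q] degree_pderiv[of q] by auto
  then obtain a where a: "q = [:a:]" by (rule degree_eq_zeroE)
  define S where "S = smult (1 / a) p"
  have S: "S \<in> P" "\<phi> = poly S \<theta>" using p q a by (auto simp: S_def field_simps)
  have "poly [:k:] \<theta> = poly (map_poly D S + smult h (pderiv S * S)) \<theta>"
    using D_poly[OF S(1)] by (simp add: k_def S(2)[symmetric] D\<theta> algebra_simps)
  then have eq: "[:k:] = map_poly D S + smult h (pderiv S * S)"
    using S h k by (subst (asm) poly_\<theta>_eq_iff) auto
  \<comment> \<open>From degree 2 on, \<open>pderiv S * S\<close> has larger degree than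
    \<open>map_poly D S\<close> and cannot be cancelled, whereas the derivative of
    \<open>\<phi>\<close> has degree 0.\<close>
  have "degree S \<le> 1"
  proof (rule ccontr)
    assume deg: "\<not> degree S \<le> 1"
    then have nz: "S \<noteq> 0" "pderiv S \<noteq> 0" using pderiv_eq_0_iff[of S] by auto
    have "degree (smult h (pderiv S * S)) = degree S - 1 + degree S"
      using nz \<open>h \<noteq> 0\<close> by (simp add: degree_mult_eq degree_pderiv)
    moreover have "degree (map_poly D S) \<le> degree S" by (rule K.degree_map_poly_D)
    ultimately have "degree [:k:] = degree S - 1 + degree S"
      unfolding eq using deg by (subst degree_add_eq_right) auto
    then show False using deg by simp
  qed
  then have "S = [:coeff S 0, coeff S 1:]"
    by (intro poly_eqI) (auto simp: coeff_pCons coeff_eq_0 split: nat.splits)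
  then have "\<phi> = coeff S 1 * \<theta> + coeff S 0" using S(2) by (metis add.commute mult.commute poly_0
      mult_zero_right add_0_right poly_pCons)
  then show ?thesis using S by (intro bexI[of _ "coeff S 1"] bexI[of _ "coeff S 0"]) auto
qed

text \<open>\<open>\<theta>\<close> is in turn affine in the new generator, so the fields agree, and
  an algebraic equation for the latter becomes one for \<open>\<theta>\<close> by composition. This
  permits a change of generator from \<open>\<theta>\<close> to the auxiliary logarithm.\<close>

lemma affine_generator:
  assumes c: "c \<in> K" "c \<noteq> 0" and d: "d \<in> K"
  shows "simple_transcendental_extension D K L (c * \<theta> + d)"
proof unfold_locales
  define \<phi> where "\<phi> = c * \<theta> + d"
  have "is_subfield (adjoin K \<phi>)"
    unfolding adjoin_def by (rule hull_in) (auto simp: is_subfield_def)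
  then interpret A: subfield "adjoin K \<phi>" by unfold_locales
  have A: "\<phi> \<in> adjoin K \<phi>" "x \<in> K \<Longrightarrow> x \<in> adjoin K \<phi>" for x
    unfolding adjoin_def by (auto intro: hull_inc)
  have "\<theta> = (\<phi> - d) / c" using c by (simp add: \<phi>_def)
  then have "\<theta> \<in> adjoin K \<phi>" using A c d by simp
  then have "L \<subseteq> adjoin K \<phi>"
    unfolding L_eq adjoin_def[of K \<theta>] using A A.is_subfield by (intro hull_minimal) auto
  moreover have "adjoin K \<phi> \<subseteq> L"
    unfolding adjoin_def[of K \<phi>] using c d L.is_subfield by (intro hull_minimal) (auto simp: \<phi>_def)
  ultimately show "L = adjoin K (c * \<theta> + d)" by (simp add: \<phi>_def)
  show "\<not> algebraic_over K (c * \<theta> + d)"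
  proof
    assume "algebraic_over K (c * \<theta> + d)"
    then obtain p where p: "p \<noteq> 0" "p \<in> P" "poly p (c * \<theta> + d) = 0"
      unfolding algebraic_over_def polys_over_def by blast
    have "poly (pcompose p [:d, c:]) \<theta> = 0" using p by (simp add: poly_pcompose algebra_simps)
    moreover have "pcompose p [:d, c:] \<in> P" using p c d by simp
    ultimately have "pcompose p [:d, c:] = 0" by simp
    then show False using p c by (simp add: pcompose_eq_0_iff)
  qed
qed (rule constants_eq)

lemma dilog_integrable_descent:
  assumes step: "(\<exists>a\<in>K. is_exponential D \<theta> a) \<or> (\<exists>a\<in>K. is_logarithm D \<theta> a) \<or>
      (\<exists>g\<in>K - {0, 1}. is_dilogarithm D L \<theta> g)"
    and f: "f \<in> K" and int: "dilog_integrable D L f"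
  shows "dilog_integrable D K f"
  using step
proof (elim disjE bexE)
  fix a assume a: "a \<in> K" "is_exponential D \<theta> a"
  then have "D \<theta> = D a * \<theta> + 0" by (auto simp: is_logarithm_def)
  then interpret affine_extension D K L \<theta> "D a" 0
    using a by unfold_locales auto
  show ?thesis using a f int by (intro exponential_descent) auto
next
  fix \<eta> assume \<eta>: "\<eta> \<in> K" "is_logarithm D \<theta> \<eta>"
  then have "D \<theta> = 0 * \<theta> + dlog D \<eta>" by (auto simp: is_logarithm_def dlog_def)
  then interpret affine_extension D K L \<theta> 0 "dlog D \<eta>"
    using \<eta> by unfold_locales auto
  show ?thesis using \<eta> f int by (intro logarithm_descent[of \<eta>]) (auto simp: is_logarithm_def)
next
  fix g assume g: "g \<in> K - {0, 1}" and "is_dilogarithm D L \<theta> g"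
  then obtain \<phi> where \<phi>: "\<phi> \<in> L" "D \<phi> = - dlog D (1 - g)" "D \<theta> = dlog D g * \<phi>"
    unfolding is_dilogarithm_def dlog_def by auto
  have "D \<phi> \<in> K" "dlog D g \<in> K" using g \<phi>(2) by auto
  then obtain c d where cd: "c \<in> K" "d \<in> K" "\<phi> = c * \<theta> + d"
    using affine_of_derivative[OF _ \<phi>(3,1)] by blast
  show ?thesis
  proof (cases "c = 0")
    case True
    then have "\<phi> \<in> K" using cd by simp
    then interpret affine_extension D K L \<theta> 0 "dlog D g * \<phi>"
      using g \<phi> by unfold_locales auto
    show ?thesis using g \<open>\<phi> \<in> K\<close> \<phi> f int by (intro dilogarithm_descent[of g \<phi>]) auto
  next
    case False
    \<comment> \<open>The reciprocal accounts for the minus sign in \<open>D \<phi>\<close>, so that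
      \<open>\<phi>\<close> is a logarithm of \<open>\<eta>\<close>.\<close>
    define \<eta> where "\<eta> = 1 / (1 - g)"
    have \<eta>: "\<eta> \<in> K - {0}" using g by (auto simp: \<eta>_def)
    have "dlog D \<eta> = - dlog D (1 - g)" unfolding \<eta>_def using g by (subst K.dlog_divide) auto
    then have D\<phi>: "D \<phi> = 0 * \<phi> + dlog D \<eta>" using \<phi>(2) by simp
    interpret \<phi>: simple_transcendental_extension D K L \<phi>
      unfolding cd(3) using cd(1) False cd(2) by (rule affine_generator)
    interpret \<phi>: affine_extension D K L \<phi> 0 "dlog D \<eta>"
      using \<eta> D\<phi> by unfold_locales auto
    show ?thesis using \<eta> f int by (intro \<phi>.logarithm_descent[of \<eta>]) auto
  qed
qed

end

section \<open>Induction down the tower\<close>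

theorem theorem1p1:
  fixes D :: "'a::field_char_0 \<Rightarrow> 'a"
    and F E :: "'a set"
    and \<theta> :: "nat \<Rightarrow> 'a"
    and n :: nat
    and u :: 'a
  assumes "differential_field D F"
    and "transcendental_dilog_elementary_extension D F E n \<theta>"
    and "constants D E = constants D F"
    and "u \<in> E"
  shows "D u \<in> F \<longleftrightarrow>
    (\<exists>(I :: nat set) (r :: nat \<Rightarrow> 'a) (g :: nat \<Rightarrow> 'a) (w :: 'a)
       (c :: nat \<Rightarrow> 'a) (cc :: nat \<Rightarrow> nat \<Rightarrow> 'a).
       finite I \<and>
       (\<forall>i\<in>I. r i \<in> F) \<and>
       (\<forall>i\<in>I. g i \<in> F - {0, 1}) \<and>
       w \<in> F \<and>
       (\<forall>i\<in>I. c i \<in> constants D F) \<and>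
       (\<forall>i\<in>I. \<forall>j\<in>I. cc i j \<in> constants D F \<and> cc i j = cc j i) \<and>
       D u = (\<Sum>i\<in>I. r i * (D (g i) / g i)) + D w \<and>
       (\<forall>i\<in>I. D (r i) = c i * (D (1 - g i) / (1 - g i)) + (\<Sum>j\<in>I. cc i j * (D (g j) / g j))))"
proof -
  let ?T = "tower F \<theta>"
  have E: "E = ?T n" and T: "\<And>i. i \<le> n \<Longrightarrow> differential_field D (?T i)"
    and gen: "\<And>i. i < n \<Longrightarrow> \<not> algebraic_over (?T i) (\<theta> i) \<and>
      ((\<exists>a\<in>?T i. is_exponential D (\<theta> i) a) \<or> (\<exists>a\<in>?T i. is_logarithm D (\<theta> i) a) \<or>
       (\<exists>g\<in>?T i - {0, 1}. is_dilogarithm D (?T (Suc i)) (\<theta> i) g))"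
    using assms(2)
    unfolding transcendental_dilog_elementary_extension_def dilog_elementary_extension_def by blast+
  have "?T i \<subseteq> ?T (Suc i)" for i
    by (auto simp: adjoin_def intro: hull_inc)
  then have mono: "?T i \<subseteq> ?T j" if "i \<le> j" for i j
    using that by (rule lift_Suc_mono_le)
  \<comment> \<open>The constants of each stage lie between those of \<open>F\<close> and those of
    \<open>E\<close>, which coincide.\<close>
  have const: "constants D (?T i) = constants D F" if "i \<le> n" for i
    using mono[of 0 i] mono[OF that] assms(3) E unfolding constants_def by auto
  have descent: "dilog_integrable D (?T k) (D u)" if "D u \<in> F" "k \<le> n" for k
    using \<open>k \<le> n\<close>
  proof (induction rule: inc_induct)
    case base
    interpret diff_field D "?T n" using T by unfold_locales auto
    \<comment> \<open>At the top the integrand is already exact: take the empty family and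
      \<open>w = u\<close>.\<close>
    show ?case
      using assms(4) E by (intro dilog_integrableI[where I = "{} :: nat set" and w = u]) auto
  next
    case (step k)
    interpret simple_transcendental_extension D "?T k" "?T (Suc k)" "\<theta> k"
    proof unfold_locales
      show "constants D (?T (Suc k)) = constants D (?T k)"
        using step.hyps const[of k] const[of "Suc k"] by simp
    qed (use T[of k] T[of "Suc k"] conjunct1[OF gen[of k]] step.hyps in auto)
    show ?case
      using gen[of k] step mono[of 0 k] that(1) by (intro dilog_integrable_descent) auto
  qed
  interpret F: diff_field D F using assms(1) by unfold_locales
  have "D u \<in> F \<longleftrightarrow> dilog_integrable D F (D u)"
  proof
    \<comment> \<open>In the converse direction every summand of the representation visibly lies in
      \<open>F\<close>.\<close>
    show "D u \<in> F" if "dilog_integrable D F (D u)"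
      by (rule F.dilog_integrableE[OF that]) (auto intro!: F.add_mem F.sum_mem)
    show "dilog_integrable D F (D u)" if "D u \<in> F"
      using descent[OF that, of 0] by simp
  qed
  then show ?thesis unfolding dilog_integrable_def dlog_def .
qed

end
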